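(* Let $\mathcal{M}=(S,A,AP,L,I)$ be an interval Markov decision process and let $s,t\in S$ with $s\sim_{(\exists\sigma\forall)} t$. Then for every PCTL state formula $\varphi$ we have $s\models_{(\exists\sigma\forall)}\varphi$ if and only if $t\models_{(\exists\sigma\forall)}\varphi$.
   Context: An interval MDP (IMDP) is a tuple $(S,A,AP,L,I)$ with $S$ a finite set of states, $A$ a finite set of actions, $AP$ a finite set of atomic propositions, $L:S\to 2^{AP}$ a labelling, and $I:S\times A\times S\to\mathbb{I}$ where $\mathbb{I}$ is a set of subintervals of $[0,1]$. For $s\in S,a\in A$, write $s\xrightarrow{a}\mu$ if $\mu$ is a probability distribution on $S$ with $\mu(s')\in I(s,a,s')$ for all $s'$; the set $\Gamma_{s,a}=\{\mu\mid s\xrightarrow{a}\mu\}$ is required to be non-empty. A scheduler is a function $\sigma$ from finite paths to distributions over $A$; a nature is a function $\pi$ mapping a finite path $\omega$ and action $a$ to an element of $\Gamma_{\mathrm{last}(\omega),a}$, where $\mathrm{last}(\omega)$ is the last state of $\omega$. $\Sigma,\Pi$ denote the sets of all schedulers and natures. $\Pr^{\sigma,\pi}_s$ is the unique probability measure on infinite paths (cylinder $\sigma$-algebra) with the one-state cylinder of $s'$ having probability $1$ iff $s'=s$ (else $0$), and $\Pr^{\sigma,\pi}_s[\mathrm{Cyl}(\omega s')]=\Pr^{\sigma,\pi}_s[\mathrm{Cyl}(\omega)]\cdot\sum_{a}\sigma(\omega)(a)\pi(\omega,a)(s')$. PCTL: state formulas $\varphi::=\mathit{true}\mid x\mid\neg\varphi\mid\varphi_1\wedge\varphi_2\mid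 \mathsf{P}_{\bowtie p}(\psi)$, path formulas $\psi::=\mathsf{X}\varphi\mid\varphi_1\mathsf{U}\varphi_2\mid\varphi_1\mathsf{U}^{\le k}\varphi_2$ ($x\in AP$, rational $p\in[0,1]$, $\bowtie\in\{\le,<,\ge,>\}$, $k\in\mathbb{N}$). The relation $\models_{(\exists\sigma\forall)}$: $s\models x$ iff $x\in L(s)$; negation, conjunction as usual; $s\models_{(\exists\sigma\forall)}\mathsf{P}_{\bowtie p}(\psi)$ iff there exists $\sigma\in\Sigma$ such that for all $\pi\in\Pi$, $\Pr^{\sigma,\pi}_s[\{\omega\mid\omega\models_{(\exists\sigma\forall)}\psi\}]\bowtie p$. For $\omega=s_1s_2\cdots$: $\omega\models\mathsf{X}\varphi$ iff $s_2\models\varphi$; $\omega\models\varphi_1\mathsf{U}^{\le k}\varphi_2$ iff some $i\le k$ has $s_i\models\varphi_2$ and $s_j\models\varphi_1$ for all $j<i$; $\omega\models\varphi_1\mathsf{U}\varphi_2$ iff $\omega\models\varphi_1\mathsf{U}^{\le k}\varphi_2$ for some $k$. For $\rho\in\mathrm{Dist}(A)$ write $s\xrightarrow{\rho}\mu$ if there are $\mu_a\in\Gamma_{s,a}$ ($a\in A$) with $\mu=\sum_a\rho(a)\mu_a$. An equivalence relation $R\subseteq S\times S$ is a probabilistic $(\exists\sigma\forall)$-bisimulation if for all $(s,t)\in R$: $L(s)=L(t)$, and for each $\rho_s\in\mathrm{Dist}(A)$ there is $\rho_t\in\mathrm{Dist}(A)$ such that for each $t\xrightarrow{\rho_t}\nu$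 there is $s\xrightarrow{\rho_s}\mu$ with $\mu(C)=\nu(C)$ for every equivalence class $C$ of $R$. $s\sim_{(\exists\sigma\forall)}t$ iff some such bisimulation contains $(s,t)$. *)

theory Defs
  imports "HOL-Probability.Probability"
begin

text \<open>An IMDP over finite state type 's, finite action type 'a and finite type 'p of
atomic propositions is given by a labelling L and an interval function I.
I s a s' is a (possibly open / half-open / degenerate) subinterval of [0,1].\<close>

definition Gamma :: "('s \<Rightarrow> 'a \<Rightarrow> 's \<Rightarrow> real set) \<Rightarrow> 's \<Rightarrow> 'a \<Rightarrow> 's pmf set" where
  "Gamma I s a = {\<mu>. \<forall>s'. pmf \<mu> s' \<in> I s a s'}"

definition imdp :: "('s::finite \<Rightarrow> 'a::finite \<Rightarrow> 's \<Rightarrow> real set) \<Rightarrow> bool" where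
  "imdp I \<longleftrightarrow> (\<forall>s a s'. is_interval (I s a s') \<and> I s a s' \<subseteq> {0..1})
               \<and> (\<forall>s a. Gamma I s a \<noteq> {})"

text \<open>Finite paths are non-empty lists of states; schedulers map finite paths to
distributions over actions; natures pick, for each finite path and action, a
distribution in Gamma of the last state.\<close>

definition schedulers :: "('s list \<Rightarrow> 'a pmf) set" where
  "schedulers = UNIV"

definition natures :: "('s \<Rightarrow> 'a \<Rightarrow> 's \<Rightarrow> real set) \<Rightarrow> ('s list \<Rightarrow> 'a \<Rightarrow> 's pmf) set" where
  "natures I = {\<pi>. \<forall>\<omega> a. \<omega> \<noteq> [] \<longrightarrow> \<pi> \<omega> a \<in> Gamma I (last \<omega>) a}"

definition cyl :: "'s list \<Rightarrow> 's stream set" where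
  "cyl \<omega> = {x. stake (length \<omega>) x = \<omega>}"

definition path_measure ::
  "('s list \<Rightarrow> 'a::finite pmf) \<Rightarrow> ('s list \<Rightarrow> 'a \<Rightarrow> 's pmf) \<Rightarrow> 's \<Rightarrow> 's stream measure" where
  "path_measure \<sigma> \<pi> s = (THE M.
      sets M = sets (stream_space (count_space UNIV)) \<and> prob_space M \<and>
      (\<forall>s'. measure M (cyl [s']) = (if s' = s then 1 else 0)) \<and>
      (\<forall>\<omega> s'. \<omega> \<noteq> [] \<longrightarrow>
          measure M (cyl (\<omega> @ [s'])) =
          measure M (cyl \<omega>) * (\<Sum>a\<in>UNIV. pmf (\<sigma> \<omega>) a * pmf (\<pi> \<omega> a) s')))"

datatype cmp = CLe | CLt | CGe | CGt

fun cmp_holds :: "cmp \<Rightarrow> real \<Rightarrow> real \<Rightarrow> bool" where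
  "cmp_holds CLe x p = (x \<le> p)"
| "cmp_holds CLt x p = (x < p)"
| "cmp_holds CGe x p = (x \<ge> p)"
| "cmp_holds CGt x p = (x > p)"

datatype 'p sform = STrue | SAtom 'p | SNot "'p sform" | SAnd "'p sform" "'p sform"
  | SProb cmp rat "'p pform"
and 'p pform = PNext "'p sform" | PUntil "'p sform" "'p sform"
  | PBUntil "'p sform" nat "'p sform"

fun wf_sform :: "'p sform \<Rightarrow> bool" and wf_pform :: "'p pform \<Rightarrow> bool" where
  "wf_sform STrue = True"
| "wf_sform (SAtom x) = True"
| "wf_sform (SNot f) = wf_sform f"
| "wf_sform (SAnd f g) = (wf_sform f \<and> wf_sform g)"
| "wf_sform (SProb c p \<psi>) = (0 \<le> p \<and> p \<le> 1 \<and> wf_pform \<psi>)"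
| "wf_pform (PNext f) = wf_sform f"
| "wf_pform (PUntil f g) = (wf_sform f \<and> wf_sform g)"
| "wf_pform (PBUntil f k g) = (wf_sform f \<and> wf_sform g)"

text \<open>Semantics (exists-sigma-forall). Paths are streams; the paper's s_i is snth w (i-1),
so "some i \<le> k (i \<ge> 1)" becomes "some i < k" with 0-based indexing.\<close>
fun sat :: "('s \<Rightarrow> 'a::finite \<Rightarrow> 's \<Rightarrow> real set) \<Rightarrow> ('s \<Rightarrow> 'p set) \<Rightarrow> 's \<Rightarrow> 'p sform \<Rightarrow> bool"
and psat :: "('s \<Rightarrow> 'a::finite \<Rightarrow> 's \<Rightarrow> real set) \<Rightarrow> ('s \<Rightarrow> 'p set) \<Rightarrow> 's stream \<Rightarrow> 'p pform \<Rightarrow> bool"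
where
  "sat I L s STrue = True"
| "sat I L s (SAtom x) = (x \<in> L s)"
| "sat I L s (SNot f) = (\<not> sat I L s f)"
| "sat I L s (SAnd f g) = (sat I L s f \<and> sat I L s g)"
| "sat I L s (SProb c p \<psi>) =
     (\<exists>\<sigma>\<in>schedulers. \<forall>\<pi>\<in>natures I.
        cmp_holds c (measure (path_measure \<sigma> \<pi> s) {w. psat I L w \<psi>}) (of_rat p))"
| "psat I L w (PNext f) = sat I L (w !! 1) f"
| "psat I L w (PBUntil f k g) =
     (\<exists>i<k. sat I L (w !! i) g \<and> (\<forall>j<i. sat I L (w !! j) f))"
| "psat I L w (PUntil f g) =
     (\<exists>k. \<exists>i<k. sat I L (w !! i) g \<and> (\<forall>j<i. sat I L (w !! j) f))"

definition trans_mix ::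
  "('s \<Rightarrow> 'a::finite \<Rightarrow> 's \<Rightarrow> real set) \<Rightarrow> 's \<Rightarrow> 'a pmf \<Rightarrow> 's pmf \<Rightarrow> bool" where
  "trans_mix I s \<rho> \<mu> \<longleftrightarrow> (\<exists>f. (\<forall>a. f a \<in> Gamma I s a) \<and>
      (\<forall>x. pmf \<mu> x = (\<Sum>a\<in>UNIV. pmf \<rho> a * pmf (f a) x)))"

definition bisim ::
  "('s \<Rightarrow> 'a::finite \<Rightarrow> 's \<Rightarrow> real set) \<Rightarrow> ('s \<Rightarrow> 'p set) \<Rightarrow> ('s \<times> 's) set \<Rightarrow> bool" where
  "bisim I L R \<longleftrightarrow> equiv UNIV R \<and>
     (\<forall>(s, t)\<in>R. L s = L t \<and>
        (\<forall>\<rho>s. \<exists>\<rho>t. \<forall>\<nu>. trans_mix I t \<rho>t \<nu> \<longrightarrow>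
           (\<exists>\<mu>. trans_mix I s \<rho>s \<mu> \<and>
              (\<forall>C\<in>UNIV // R. measure_pmf.prob \<mu> C = measure_pmf.prob \<nu> C))))"

definition bisimilar ::
  "('s \<Rightarrow> 'a::finite \<Rightarrow> 's \<Rightarrow> real set) \<Rightarrow> ('s \<Rightarrow> 'p set) \<Rightarrow> 's \<Rightarrow> 's \<Rightarrow> bool" where
  "bisimilar I L s t \<longleftrightarrow> (\<exists>R. bisim I L R \<and> (s, t) \<in> R)"

end

theory Submission
  imports Defs
begin

text \<open>
The scheduler commits first and nature may answer each of its distributions, so only the best
guarantee of the scheduler matters. A scheduler cannot be simulated path by path, because the
weights of the paths with a common trace of classes are under the control of nature. Instead, the
guarantees themselves are shown to be invariant under bisimilarity.

For a bounded until, the sets of values that nature can enforce against a scheduler are upward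
closed, hence linearly ordered by inclusion. The simulating scheduler can therefore continue in
each class with the best of the continuations that are available in that class.

For an unbounded until, the value is a limit of value iteration and thus invariant, and the
scheduler attains it: a positional choice that is optimal for discount factors arbitrarily close
to 1 is optimal. Since intervals may be open, nature need not attain the value, so strict
thresholds need the set of states from which the scheduler forces a strictly better probability.
It is a least fixed point if the scheduler maximises, and a least fixed point of greatest fixed
points if it minimises (nature may also fail by never making progress). Both fixed points are built
from an operator that bisimulation preserves.
\<close>

section \<open>The path measure of a history-dependent kernel\<close>

text \<open>Bisimulation carries over exactly one kind of statement: some mixed action such that
  every answer of nature satisfies a property that depends only on the masses of classes
  (\<open>transfer_choice\<close>). Guarantees about infinite plays are therefore rebuilt from
  one-step guarantees of this form.

  The players are not symmetric. A player who avoids the goal only has to keep the expected value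
  from drifting towards the opponent, since endless play is in its favour. A player who wants to
  reach the goal can preserve the value for ever, say by looping in a state of value 1, and still
  get nothing. So the maximising scheduler, and nature against a minimising one, need an argument
  for progress. Discounting supplies it for the scheduler, and for nature up to any positive loss;
  where nature must meet the value exactly, it follows a rank that tells how early a state drops out
  of the inner greatest fixed point.

  The scheduler attains values because there are finitely many actions. Nature chooses from sets
  that need not be closed, so its errors are paid from a budget: one given in advance, or one opened
  by a step that costs the scheduler expected value.\<close>

definition path_dist :: "('s list \<Rightarrow> 's pmf) \<Rightarrow> 's \<Rightarrow> 's stream measure \<Rightarrow> bool" where
  "path_dist \<kappa> s M \<longleftrightarrow> sets M = sets (stream_space (count_space UNIV)) \<and> prob_space M \<and>
      (\<forall>s'. measure M (cyl [s']) = (if s' = s then 1 else 0)) \<and>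
      (\<forall>\<omega> s'. \<omega> \<noteq> [] \<longrightarrow> measure M (cyl (\<omega> @ [s'])) = measure M (cyl \<omega>) * pmf (\<kappa> \<omega>) s')"

lemma cyl_eq_sstart: "cyl \<omega> = sstart UNIV \<omega>"
proof (induction \<omega>)
  case Nil
  then show ?case by (simp add: cyl_def)
next
  case (Cons x \<omega>)
  show ?case using Cons by (auto simp: cyl_def set_eq_iff)
qed

lemma cyl_measurable: "cyl \<omega> \<in> sets (stream_space (count_space UNIV))"
  unfolding cyl_eq_sstart by (rule sstart_sets)

text \<open>The defining clauses determine the mass of the cylinder of every nonempty word, by
  induction from the right end, and these cylinders determine a measure on streams.\<close>

lemma path_dist_unique:
  fixes M N :: "'s::finite stream measure"
  assumes M: "path_dist \<kappa> s M" and N: "path_dist \<kappa> s N"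
  shows "M = N"
proof (rule stream_space_eq_sstart[of UNIV])
  have *: "measure M (cyl xs) = measure N (cyl xs)" if "xs \<noteq> []" for xs
    using that
  proof (induction xs rule: rev_induct)
    case (snoc x xs)
    then show ?case using M N
      by (cases "xs = []") (auto simp: path_dist_def)
  qed simp
  interpret M: prob_space M using M by (simp add: path_dist_def)
  interpret N: prob_space N using N by (simp add: path_dist_def)
  show "emeasure M (sstart UNIV xs) = emeasure N (sstart UNIV xs)" if "xs \<noteq> []" for xs
    using *[OF that] by (simp add: cyl_eq_sstart M.emeasure_eq_measure N.emeasure_eq_measure)
qed (use M N in \<open>auto simp: path_dist_def countable_finite\<close>)

text \<open>Ionescu-Tulcea extension: coordinate 0 is drawn from the point mass at \<open>s\<close>,
  coordinate \<open>i\<close> from \<open>\<kappa>\<close> applied to the list of the earlier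
  coordinates. The limit measure on functions is pushed forward to streams.\<close>

lemma path_dist_exists:
  fixes \<kappa> :: "'s::finite list \<Rightarrow> 's pmf"
  shows "\<exists>M. path_dist \<kappa> s M"
proof -
  define M where "M = (\<lambda>i::nat. count_space (UNIV::'s set))"
  define P where "P i x = measure_pmf (if i = 0 then return_pmf s else \<kappa> (map x [0..<i]))"
    for i and x :: "nat \<Rightarrow> 's"
  \<comment> \<open>Finite products of discrete spaces over a finite type are discrete, so every
    measurability obligation for the kernels is trivial.\<close>
  have PiM: "PiM J M = count_space (PiE J (\<lambda>_. UNIV))" if "finite J" for J
    unfolding M_def by (rule count_space_PiM_finite) (auto simp: that countable_finite)
  interpret Ionescu_Tulcea P M
  proof (rule Ionescu_Tulcea.intro)
    fix i x
    show "P i \<in> PiM {0..<i} M \<rightarrow>\<^sub>M subprob_algebra (M i)"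
      by (simp add: PiM) (auto simp: P_def M_def measure_pmf_in_subprob_algebra)
    show "prob_space (P i x)"
      by (simp add: P_def measure_pmf.prob_space_axioms)
  qed
  \<comment> \<open>A word as a point of the finite product; its singleton is the base of the
    cylinder, and \<open>c\<close> below is its mass.\<close>
  define pt where "pt \<omega> = restrict (\<lambda>i. \<omega> ! i) {0..<length \<omega>}" for \<omega> :: "'s list"
  have map_pt: "map (pt \<omega>) [0..<length \<omega>] = \<omega>" for \<omega>
    by (rule nth_equalityI) (auto simp: pt_def)
  define c where "c \<omega> = emeasure (C 0 (length \<omega>) (\<lambda>_. undefined)) {pt \<omega>}" for \<omega>
  have pt_sets: "{pt \<omega>} \<in> sets (PiM {0..<length \<omega>} M)" for \<omega>
    by (auto simp: PiM pt_def)
  have und: "(\<lambda>_. undefined) \<in> space (PiM {0..<0} M)" by (simp add: PiM)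
  have c_Nil: "c [] = 1"
    by (simp add: c_def pt_def PiM restrict_def)
  have c_snoc: "c (\<omega> @ [x]) = c \<omega> * pmf (if \<omega> = [] then return_pmf s else \<kappa> \<omega>) x" for \<omega> x
  proof -
    let ?n = "length \<omega>" and ?Q = "if \<omega> = [] then return_pmf s else \<kappa> \<omega>"
    have "c (\<omega> @ [x]) = emeasure (C 0 ?n (\<lambda>_. undefined) \<bind> eP ?n) {pt (\<omega> @ [x])}"
      by (simp add: c_def)
    also have "\<dots> = (\<integral>\<^sup>+ y. emeasure (eP ?n y) {pt (\<omega> @ [x])} \<partial>C 0 ?n (\<lambda>_. undefined))"
      using pt_sets[of "\<omega> @ [x]"] measurable_eP[of ?n] space_C[OF und, of ?n] sets_C[OF und, of ?n]
      by (intro emeasure_bind[where N="PiM {0..<Suc ?n} M"])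
         (auto simp: PiM measurable_cong_sets[OF sets_C[OF und] refl])
    also have "\<dots> = (\<integral>\<^sup>+ y. ennreal (pmf ?Q x) * indicator {pt \<omega>} y \<partial>C 0 ?n (\<lambda>_. undefined))"
    proof (rule nn_integral_cong)
      fix y assume "y \<in> space (C 0 ?n (\<lambda>_. undefined))"
      then have y: "y \<in> space (PiM {0..<?n} M)" using space_C[OF und, of ?n] by simp
      then have ext: "y \<in> extensional {0..<?n}" by (auto simp: PiM PiE_def)
      have "emeasure (eP ?n y) {pt (\<omega> @ [x])} = P ?n y ((\<lambda>z. y(?n := z)) -` {pt (\<omega> @ [x])} \<inter> space (M ?n))"
        using pt_sets[of "\<omega> @ [x]"] by (intro emeasure_eP[OF y]) simp
      also have "(\<lambda>z. y(?n := z)) -` {pt (\<omega> @ [x])} \<inter> space (M ?n) = (if y = pt \<omega> then {x} else {})"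
      proof -
        have "y(?n := z) = pt (\<omega> @ [x]) \<longleftrightarrow> y = pt \<omega> \<and> z = x" for z
        proof
          assume a: "y(?n := z) = pt (\<omega> @ [x])"
          have "y i = pt \<omega> i" for i
            using fun_cong[OF a, of i] ext
            by (cases "i < ?n") (auto simp: pt_def nth_append extensional_def)
          moreover have "z = x" using fun_cong[OF a, of ?n] by (auto simp: pt_def)
          ultimately show "y = pt \<omega> \<and> z = x" by auto
        next
          assume "y = pt \<omega> \<and> z = x"
          then show "y(?n := z) = pt (\<omega> @ [x])"
            by (auto simp: pt_def fun_eq_iff nth_append)
        qed
        then show ?thesis by (auto simp: M_def)
      qed
      also have "P ?n y \<dots> = ennreal (pmf ?Q x) * indicator {pt \<omega>} y"
        by (auto simp: P_def map_pt emeasure_pmf_single split: split_indicator)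
      finally show "emeasure (eP ?n y) {pt (\<omega> @ [x])} = ennreal (pmf ?Q x) * indicator {pt \<omega>} y" .
    qed
    also have "\<dots> = ennreal (pmf ?Q x) * c \<omega>"
      unfolding c_def using pt_sets[of \<omega>] sets_C[OF und, of ?n]
      by (subst nn_integral_cmult) (auto simp: nn_integral_indicator intro!: borel_measurable_indicator)
    finally show ?thesis by (simp add: mult.commute)
  qed
  define N where "N = distr PF.lim (stream_space (count_space UNIV)) to_stream"
  have setslim: "sets PF.lim = sets (PiM UNIV (\<lambda>_. count_space UNIV))"
    unfolding PF.sets_lim by (simp add: M_def)
  have ts: "to_stream \<in> PF.lim \<rightarrow>\<^sub>M stream_space (count_space UNIV)"
    by (subst measurable_cong_sets[OF setslim refl]) (rule measurable_to_stream)
  \<comment> \<open>The total mass of the limit is read off its projection to the empty index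
    set.\<close>
  have restr: "(\<lambda>x. restrict x {}) \<in> PF.lim \<rightarrow>\<^sub>M PiM {} M"
    by (subst measurable_cong_sets[OF PF.sets_lim refl]) (auto intro!: measurable_restrict)
  interpret lim: prob_space PF.lim
    by (rule prob_space_distrD[OF restr]) (simp add: distr_lim PF.prob_space_P)
  interpret N: prob_space N unfolding N_def by (rule lim.prob_space_distr[OF ts])
  have N_cyl: "emeasure N (cyl \<omega>) = c \<omega>" for \<omega>
  proof -
    have "emeasure N (cyl \<omega>) = emeasure PF.lim (to_stream -` cyl \<omega> \<inter> space PF.lim)"
      unfolding N_def using ts cyl_measurable by (rule emeasure_distr)
    also have "to_stream -` cyl \<omega> \<inter> space PF.lim = PF.emb UNIV {0..<length \<omega>} {pt \<omega>}"
    proof -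
      have "to_stream y \<in> cyl \<omega> \<longleftrightarrow> restrict y {0..<length \<omega>} = pt \<omega>" for y
        unfolding cyl_eq_sstart
        by (subst sstart_eq) (auto simp: to_stream_def pt_def fun_eq_iff restrict_def)
      moreover have "space PF.lim = UNIV" unfolding PF.space_lim by (simp add: space_PiM M_def)
      ultimately show ?thesis by (auto simp: prod_emb_def M_def)
    qed
    also have "emeasure PF.lim \<dots> = emeasure (CI {0..<length \<omega>}) {pt \<omega>}"
      by (rule lim) (auto simp: pt_sets)
    also have "\<dots> = c \<omega>"
      proof -
      have "PF.emb {0..<length \<omega>} {0..<length \<omega>} {pt \<omega>} = {pt \<omega>}"
        by (rule prod_emb_id) (auto simp: M_def pt_def)
      then show ?thesis
        unfolding c_def using pt_sets[of \<omega>] by (subst emeasure_CI[of _ "length \<omega>"]) auto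
    qed
    finally show ?thesis .
  qed
  have m: "ennreal (measure N (cyl \<omega>)) = c \<omega>" for \<omega>
    using N_cyl by (simp add: N.emeasure_eq_measure)
  have snoc: "measure N (cyl (\<omega> @ [x])) = measure N (cyl \<omega>) * pmf (if \<omega> = [] then return_pmf s else \<kappa> \<omega>) x" for \<omega> x
    using c_snoc[of \<omega> x] unfolding m[symmetric] by (simp add: ennreal_mult[symmetric])
  \<comment> \<open>With mass 1 for the empty word, the extension rule at \<open>[]\<close>, where
    the kernel is \<open>return_pmf s\<close>, is the clause for one-state cylinders.\<close>
  have "measure N (cyl []) = 1" using m[of "[]"] c_Nil by simp
  then have "path_dist \<kappa> s N"
    unfolding path_dist_def using snoc snoc[of "[]"]
    by (auto simp: N_def intro: N.prob_space_axioms[unfolded N_def])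
  then show ?thesis by blast
qed


section \<open>Probabilities of until formulas\<close>

definition expv :: "'s::finite pmf \<Rightarrow> ('s \<Rightarrow> real) \<Rightarrow> real" where
  "expv \<mu> x = (\<Sum>s\<in>UNIV. pmf \<mu> s * x s)"

text \<open>The bound counts inspected states rather than steps, in agreement with
  \<open>i < k\<close> in \<open>psat\<close>; hence bound 0 gives 0.\<close>

fun buntil_prob :: "'s::finite set \<Rightarrow> 's set \<Rightarrow> ('s list \<Rightarrow> 's pmf) \<Rightarrow> nat \<Rightarrow> 's list \<Rightarrow> real" where
  "buntil_prob F G \<kappa> 0 \<omega> = 0"
| "buntil_prob F G \<kappa> (Suc k) \<omega> = (if last \<omega> \<in> G then 1 else if last \<omega> \<notin> F then 0
     else expv (\<kappa> \<omega>) (\<lambda>s. buntil_prob F G \<kappa> k (\<omega> @ [s])))"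

text \<open>Taken as a limit of bounded probabilities so that the game arguments stay free of
  measure theory; \<open>measure_until\<close> makes the link to the path measure.\<close>

definition until_prob :: "'s::finite set \<Rightarrow> 's set \<Rightarrow> ('s list \<Rightarrow> 's pmf) \<Rightarrow> 's list \<Rightarrow> real" where
  "until_prob F G \<kappa> \<omega> = (SUP k. buntil_prob F G \<kappa> k \<omega>)"

lemma sum_pmf_UNIV: "(\<Sum>s\<in>UNIV. pmf \<mu> s) = 1" for \<mu> :: "'s::finite pmf"
  by (simp add: sum_pmf_eq_1)

lemma expv_mono:
  assumes "\<And>s. s \<in> set_pmf \<mu> \<Longrightarrow> x s \<le> y s"
  shows "expv \<mu> x \<le> expv \<mu> y"
  unfolding expv_def
proof (rule sum_mono)
  fix s show "pmf \<mu> s * x s \<le> pmf \<mu> s * y s"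
    by (cases "s \<in> set_pmf \<mu>") (auto simp: assms mult_left_mono set_pmf_iff)
qed

lemma expv_cong: "(\<And>s. s \<in> set_pmf \<mu> \<Longrightarrow> x s = y s) \<Longrightarrow> expv \<mu> x = expv \<mu> y"
  by (intro antisym expv_mono) auto

lemma expv_const [simp]: "expv \<mu> (\<lambda>_. c) = c"
  by (simp add: expv_def sum_distrib_right[symmetric] sum_pmf_UNIV)

lemma expv_add: "expv \<mu> (\<lambda>s. x s + y s) = expv \<mu> x + expv \<mu> y"
  by (simp add: expv_def sum.distrib algebra_simps)

lemma expv_diff: "expv \<mu> (\<lambda>s. x s - y s) = expv \<mu> x - expv \<mu> y"
  by (simp add: expv_def sum_subtractf algebra_simps)

lemma expv_cmult: "expv \<mu> (\<lambda>s. c * x s) = c * expv \<mu> x"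
  by (simp add: expv_def sum_distrib_left algebra_simps)

lemma expv_minus: "expv \<mu> (\<lambda>s. - x s) = - expv \<mu> x"
  by (simp add: expv_def sum_negf)

lemma expv_strict_mono:
  assumes "\<And>s. s \<in> set_pmf \<mu> \<Longrightarrow> x s \<le> y s" and "z \<in> set_pmf \<mu>" "x z < y z"
  shows "expv \<mu> x < expv \<mu> y"
  unfolding expv_def
proof (rule sum_strict_mono_ex1)
  show "\<forall>s\<in>UNIV. pmf \<mu> s * x s \<le> pmf \<mu> s * y s"
  proof
    fix s show "pmf \<mu> s * x s \<le> pmf \<mu> s * y s"
      by (cases "s \<in> set_pmf \<mu>") (auto simp: assms mult_left_mono set_pmf_iff)
  qed
  show "\<exists>s\<in>UNIV. pmf \<mu> s * x s < pmf \<mu> s * y s"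
    using assms(2,3) by (intro bexI[of _ z]) (auto simp: pmf_positive)
qed simp

lemma expv_indicator: "expv \<mu> (indicator A) = measure_pmf.prob \<mu> A"
  by (simp add: expv_def measure_measure_pmf_finite sum.inter_restrict[symmetric] Int_def
      indicator_def if_distrib sum.If_cases cong: if_cong)

lemma buntil_prob_nonneg: "0 \<le> buntil_prob F G \<kappa> k \<omega>"
proof (induction k arbitrary: \<omega>)
  case (Suc k)
  have "expv (\<kappa> \<omega>) (\<lambda>s. 0) \<le> expv (\<kappa> \<omega>) (\<lambda>s. buntil_prob F G \<kappa> k (\<omega> @ [s]))"
    by (rule expv_mono) (rule Suc)
  then show ?case by simp
qed simp

lemma buntil_prob_le_1: "buntil_prob F G \<kappa> k \<omega> \<le> 1"
proof (induction k arbitrary: \<omega>)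
  case (Suc k)
  have "expv (\<kappa> \<omega>) (\<lambda>s. buntil_prob F G \<kappa> k (\<omega> @ [s])) \<le> expv (\<kappa> \<omega>) (\<lambda>s. 1)"
    by (rule expv_mono) (rule Suc)
  then show ?case by simp
qed simp

lemma buntil_prob_Suc_mono: "buntil_prob F G \<kappa> k \<omega> \<le> buntil_prob F G \<kappa> (Suc k) \<omega>"
proof (induction k arbitrary: \<omega>)
  case 0
  show ?case using buntil_prob_nonneg[of F G \<kappa> "Suc 0"] by (simp del: buntil_prob.simps(2))
next
  case (Suc k)
  have "expv (\<kappa> \<omega>) (\<lambda>s. buntil_prob F G \<kappa> k (\<omega> @ [s])) \<le> expv (\<kappa> \<omega>) (\<lambda>s. buntil_prob F G \<kappa> (Suc k) (\<omega> @ [s]))"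
    by (rule expv_mono) (rule Suc)
  then show ?case by (subst (1 2) buntil_prob.simps(2)) (simp del: buntil_prob.simps)
qed

lemma buntil_prob_tendsto: "(\<lambda>k. buntil_prob F G \<kappa> k \<omega>) \<longlonglongrightarrow> until_prob F G \<kappa> \<omega>"
  unfolding until_prob_def
  by (rule LIMSEQ_incseq_SUP) (auto intro!: bdd_aboveI2[where M=1] incseq_SucI buntil_prob_Suc_mono buntil_prob_le_1)

lemma buntil_prob_le_until_prob: "buntil_prob F G \<kappa> k \<omega> \<le> until_prob F G \<kappa> \<omega>"
  by (rule incseq_le[OF incseq_SucI buntil_prob_tendsto]) (rule buntil_prob_Suc_mono)

lemma until_prob_least: "(\<And>k. buntil_prob F G \<kappa> k \<omega> \<le> y) \<Longrightarrow> until_prob F G \<kappa> \<omega> \<le> y"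
  unfolding until_prob_def by (rule cSUP_least) auto

lemma until_prob_nonneg: "0 \<le> until_prob F G \<kappa> \<omega>" using buntil_prob_le_until_prob[of F G \<kappa> 0 \<omega>] by simp

lemma until_prob_rec: "until_prob F G \<kappa> \<omega> = (if last \<omega> \<in> G then 1 else if last \<omega> \<notin> F then 0
     else expv (\<kappa> \<omega>) (\<lambda>s. until_prob F G \<kappa> (\<omega> @ [s])))"
proof (rule LIMSEQ_unique)
  show "(\<lambda>k. buntil_prob F G \<kappa> (Suc k) \<omega>) \<longlonglongrightarrow> until_prob F G \<kappa> \<omega>"
    using buntil_prob_tendsto by (rule LIMSEQ_Suc)
  show "(\<lambda>k. buntil_prob F G \<kappa> (Suc k) \<omega>) \<longlonglongrightarrow> (if last \<omega> \<in> G then 1 else if last \<omega> \<notin> F then 0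
     else expv (\<kappa> \<omega>) (\<lambda>s. until_prob F G \<kappa> (\<omega> @ [s])))"
    unfolding buntil_prob.simps expv_def by (auto intro!: tendsto_intros buntil_prob_tendsto)
qed

lemma buntil_prob_append: "\<omega> \<noteq> [] \<Longrightarrow> buntil_prob F G \<kappa> k (xs @ \<omega>) = buntil_prob F G (\<lambda>\<omega>. \<kappa> (xs @ \<omega>)) k \<omega>"
  by (induction k arbitrary: \<omega>) simp_all

text \<open>The offset \<open>n\<close> lets the event be restarted at the last state of a prefix,
  which the induction in \<open>measure_until_event_cyl\<close> needs.\<close>

definition until_event :: "'s set \<Rightarrow> 's set \<Rightarrow> nat \<Rightarrow> nat \<Rightarrow> 's stream set" where
  "until_event F G n k = {w. \<exists>i<k. w !! (n + i) \<in> G \<and> (\<forall>j<i. w !! (n + j) \<in> F)}"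

lemma until_event_measurable:
  "until_event F G n k \<in> sets (stream_space (count_space (UNIV :: 's::finite set)))"
proof -
  have "{w \<in> space (stream_space (count_space (UNIV :: 's set))).
      \<exists>i<k. w !! (n + i) \<in> G \<and> (\<forall>j<i. w !! (n + j) \<in> F)} \<in> sets (stream_space (count_space UNIV))"
    by measurable
  then show ?thesis by (simp add: until_event_def space_stream_space)
qed

lemma until_event_Suc:
  "w \<in> until_event F G n (Suc k) \<longleftrightarrow>
     w !! n \<in> G \<or> (w !! n \<in> F \<and> w \<in> until_event F G (Suc n) k)"
proof
  assume "w \<in> until_event F G n (Suc k)"
  then obtain i where i: "i < Suc k" "w !! (n + i) \<in> G" "\<forall>j<i. w !! (n + j) \<in> F"
    by (auto simp: until_event_def)
  show "w !! n \<in> G \<or> (w !! n \<in> F \<and> w \<in> until_event F G (Suc n) k)"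
  proof (cases i)
    case (Suc m)
    then show ?thesis using i by (auto simp: until_event_def All_less_Suc2)
  qed (use i in simp)
next
  assume "w !! n \<in> G \<or> (w !! n \<in> F \<and> w \<in> until_event F G (Suc n) k)"
  then show "w \<in> until_event F G n (Suc k)"
  proof
    assume "w !! n \<in> F \<and> w \<in> until_event F G (Suc n) k"
    then obtain i where "i < k" "w !! (Suc n + i) \<in> G" "\<forall>j<i. w !! (Suc n + j) \<in> F" "w !! n \<in> F"
      by (auto simp: until_event_def)
    then show ?thesis
      unfolding until_event_def by (intro CollectI exI[of _ "Suc i"]) (auto simp: All_less_Suc2)
  qed (auto simp: until_event_def intro!: exI[of _ 0])
qed

lemma cyl_split: "cyl \<omega> = (\<Union>s. cyl (\<omega> @ [s]))"
  by (auto simp: cyl_def stake_Suc simp del: stake.simps)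

lemma cyl_snoc_disjoint: "s \<noteq> s' \<Longrightarrow> cyl (\<omega> @ [s]) \<inter> cyl (\<omega> @ [s']) = {}"
  by (auto simp: cyl_def stake_Suc simp del: stake.simps)

lemma cyl_last: "\<omega> \<noteq> [] \<Longrightarrow> w \<in> cyl \<omega> \<Longrightarrow> w !! (length \<omega> - 1) = last \<omega>"
  unfolding cyl_def by (metis (mono_tags) mem_Collect_eq last_conv_nth stake_nth diff_less length_greater_0_conv zero_less_one)

lemma measure_cyl_Int_split:
  fixes M :: "'s::finite stream measure"
  assumes M: "path_dist \<kappa> s M" and A: "A \<in> sets (stream_space (count_space UNIV))"
  shows "measure M (cyl \<omega> \<inter> A) = (\<Sum>s'\<in>UNIV. measure M (cyl (\<omega> @ [s']) \<inter> A))"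
proof -
  interpret prob_space M using M by (simp add: path_dist_def)
  have sM: "sets M = sets (stream_space (count_space UNIV))" using M by (simp add: path_dist_def)
  have "cyl \<omega> \<inter> A = (\<Union>s'\<in>UNIV. cyl (\<omega> @ [s']) \<inter> A)"
    by (subst cyl_split) auto
  also have "measure M \<dots> = (\<Sum>s'\<in>UNIV. measure M (cyl (\<omega> @ [s']) \<inter> A))"
    using cyl_snoc_disjoint[of _ _ \<omega>]
    by (intro finite_measure_finite_Union) (auto simp: sM A cyl_measurable disjoint_family_on_def)
  finally show ?thesis .
qed

text \<open>The Markov-like factorisation for history-dependent kernels: after a prefix, the event
  from its last state on is decided there or handed to the one-state extensions, whose masses carry
  the factor \<open>\<kappa> \<omega>\<close>.\<close>

lemma measure_until_event_cyl:
  fixes M :: "'s::finite stream measure"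
  assumes M: "path_dist \<kappa> s M"
  shows "\<omega> \<noteq> [] \<Longrightarrow> measure M (cyl \<omega> \<inter> until_event F G (length \<omega> - 1) k) = measure M (cyl \<omega>) * buntil_prob F G \<kappa> k \<omega>"
proof (induction k arbitrary: \<omega>)
  case 0
  then show ?case by (simp add: until_event_def)
next
  case (Suc k)
  have ev: "w \<in> until_event F G (length \<omega> - 1) (Suc k) \<longleftrightarrow>
     last \<omega> \<in> G \<or> (last \<omega> \<in> F \<and> w \<in> until_event F G (length \<omega>) k)" if "w \<in> cyl \<omega>" for w
    using cyl_last[OF Suc.prems that] Suc.prems by (simp add: until_event_Suc)
  consider "last \<omega> \<in> G" | "last \<omega> \<notin> G" "last \<omega> \<notin> F" | "last \<omega> \<notin> G" "last \<omega> \<in> F" by blast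
  then show ?case
  proof cases
    case 1
    then have "cyl \<omega> \<inter> until_event F G (length \<omega> - 1) (Suc k) = cyl \<omega>" using ev by auto
    then show ?thesis using 1 by simp
  next
    case 2
    then have "cyl \<omega> \<inter> until_event F G (length \<omega> - 1) (Suc k) = {}" using ev by auto
    then show ?thesis using 2 by simp
  next
    case 3
    then have "cyl \<omega> \<inter> until_event F G (length \<omega> - 1) (Suc k) = cyl \<omega> \<inter> until_event F G (length \<omega>) k"
      using ev by auto
    also have "measure M \<dots> = (\<Sum>s'\<in>UNIV. measure M (cyl (\<omega> @ [s']) \<inter> until_event F G (length \<omega>) k))"
      by (rule measure_cyl_Int_split[OF M until_event_measurable])
    also have "\<dots> = (\<Sum>s'\<in>UNIV. measure M (cyl \<omega>) * pmf (\<kappa> \<omega>) s' * buntil_prob F G \<kappa> k (\<omega> @ [s']))"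
      using Suc.IH[of "\<omega> @ [s']" for s'] M Suc.prems by (simp add: path_dist_def)
    finally show ?thesis using 3 by (simp add: expv_def sum_distrib_left mult.assoc)
  qed
qed

lemma measure_until_event:
  fixes M :: "'s::finite stream measure"
  assumes M: "path_dist \<kappa> s M"
  shows "measure M (until_event F G 0 k) = buntil_prob F G \<kappa> k [s]"
proof -
  have "measure M (cyl [] \<inter> until_event F G 0 k) = (\<Sum>s'\<in>UNIV. measure M (cyl [s'] \<inter> until_event F G 0 k))"
    using measure_cyl_Int_split[OF M until_event_measurable, of "[]"] by simp
  also have "\<dots> = (\<Sum>s'\<in>UNIV. (if s' = s then 1 else 0) * buntil_prob F G \<kappa> k [s'])"
    using measure_until_event_cyl[OF M, of "[s']" for s'] M by (simp add: path_dist_def)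
  also have "\<dots> = buntil_prob F G \<kappa> k [s]" by (simp add: if_distrib[of "\<lambda>x. x * _"] cong: if_cong)
  finally show ?thesis by (simp add: cyl_def)
qed

lemma measure_until:
  fixes M :: "'s::finite stream measure"
  assumes M: "path_dist \<kappa> s M"
  shows "measure M (\<Union>k. until_event F G 0 k) = until_prob F G \<kappa> [s]"
proof (rule LIMSEQ_unique)
  interpret prob_space M using M by (simp add: path_dist_def)
  have sM: "sets M = sets (stream_space (count_space UNIV))" using M by (simp add: path_dist_def)
  show "(\<lambda>k. measure M (until_event F G 0 k)) \<longlonglongrightarrow> measure M (\<Union>k. until_event F G 0 k)"
  proof (rule finite_Lim_measure_incseq)
    show "range (until_event F G 0) \<subseteq> sets M" by (auto simp: sM until_event_measurable)
    show "incseq (until_event F G 0)" by (auto simp: until_event_def incseq_def intro: less_le_trans)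
  qed
  show "(\<lambda>k. measure M (until_event F G 0 k)) \<longlonglongrightarrow> until_prob F G \<kappa> [s]"
    unfolding measure_until_event[OF M] by (rule buntil_prob_tendsto)
qed

lemma measure_next:
  fixes M :: "'s::finite stream measure"
  assumes M: "path_dist \<kappa> s M"
  shows "measure M {w. w !! 1 \<in> A} = measure_pmf.prob (\<kappa> [s]) A"
proof -
  have Am: "{w. w !! 1 \<in> A} \<in> sets (stream_space (count_space UNIV))"
  proof -
    have "{w \<in> space (stream_space (count_space (UNIV :: 's set))). w !! 1 \<in> A} \<in> sets (stream_space (count_space UNIV))"
      by measurable
    then show ?thesis by (simp add: space_stream_space)
  qed
  have "cyl [x, y] \<inter> {w. w !! 1 \<in> A} = (if y \<in> A then cyl [x, y] else {})" for x y
    by (auto simp: cyl_def numeral_2_eq_2)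
  then have 2: "measure M (cyl [x, y] \<inter> {w. w !! 1 \<in> A}) = (if x = s then 1 else 0) * (pmf (\<kappa> [x]) y * indicator A y)" for x y
    using M unfolding path_dist_def
    by (auto dest: spec[of _ "[x]"])
  have 3: "measure M (cyl [x] \<inter> {w. w !! 1 \<in> A}) = (if x = s then 1 else 0) * measure_pmf.prob (\<kappa> [x]) A" for x
    using measure_cyl_Int_split[OF M Am, of "[x]"] 2[of x]
    by (simp add: expv_indicator[symmetric] expv_def del: snth.simps)
  have "measure M (cyl [] \<inter> {w. w !! 1 \<in> A}) = (\<Sum>x\<in>UNIV. (if x = s then 1 else 0) * measure_pmf.prob (\<kappa> [x]) A)"
    using measure_cyl_Int_split[OF M Am, of "[]"] 3 by (simp del: snth.simps)
  then show ?thesis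
    by (simp add: cyl_def if_distrib[of "\<lambda>x. x * _"] cong: if_cong)
qed

section \<open>Kernels in place of natures\<close>

definition chain :: "('s list \<Rightarrow> 's pmf) \<Rightarrow> 's \<Rightarrow> 's::finite stream measure" where
  "chain \<kappa> s = (THE M. path_dist \<kappa> s M)"

lemma path_dist_chain: "path_dist \<kappa> s (chain \<kappa> s)"
  unfolding chain_def using path_dist_exists path_dist_unique by (metis theI)

lemma pmf_bind_finite: "pmf (bind_pmf \<rho> f) x = (\<Sum>a\<in>UNIV. pmf \<rho> a * pmf (f a) x)" for \<rho> :: "'a::finite pmf"
  by (simp add: pmf_bind integral_measure_pmf_real[of UNIV] mult.commute)

lemma path_measure_eq_chain: 
  fixes \<sigma> :: "'s::finite list \<Rightarrow> 'a::finite pmf"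
  assumes "\<And>\<omega>. \<omega> \<noteq> [] \<Longrightarrow> \<kappa> \<omega> = bind_pmf (\<sigma> \<omega>) (\<pi> \<omega>)"
  shows "path_measure \<sigma> \<pi> s = chain \<kappa> s"
  unfolding path_measure_def chain_def path_dist_def
  by (intro arg_cong[where f=The] ext) (auto simp: assms pmf_bind_finite)

definition admissible :: "('s \<Rightarrow> 'a::finite \<Rightarrow> 's \<Rightarrow> real set) \<Rightarrow> ('s list \<Rightarrow> 'a pmf) \<Rightarrow> ('s list \<Rightarrow> 's pmf) \<Rightarrow> bool" where
  "admissible I \<sigma> \<kappa> \<longleftrightarrow> (\<forall>\<omega>. \<omega> \<noteq> [] \<longrightarrow> trans_mix I (last \<omega>) (\<sigma> \<omega>) (\<kappa> \<omega>))"

lemma trans_mix_iff: "trans_mix I s \<rho> \<mu> \<longleftrightarrow> (\<exists>f. (\<forall>a. f a \<in> Gamma I s a) \<and> \<mu> = bind_pmf \<rho> f)"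
  unfolding trans_mix_def by (simp add: pmf_eq_iff pmf_bind_finite)

text \<open>Nature enters the measure only through the mixture of its answers under
  \<open>\<sigma> \<omega>\<close>. Conversely, choice splits an admissible kernel into answers to
  the single actions; the empty history is unconstrained on both sides.\<close>

lemma forall_natures_iff:
  fixes I :: "'s::finite \<Rightarrow> 'a::finite \<Rightarrow> 's \<Rightarrow> real set"
  shows "(\<forall>\<pi>\<in>natures I. Q (path_measure \<sigma> \<pi> s)) \<longleftrightarrow> (\<forall>\<kappa>. admissible I \<sigma> \<kappa> \<longrightarrow> Q (chain \<kappa> s))"
proof safe
  fix \<pi> assume *: "\<forall>\<kappa>. admissible I \<sigma> \<kappa> \<longrightarrow> Q (chain \<kappa> s)" "\<pi> \<in> natures I"
  have "admissible I \<sigma> (\<lambda>\<omega>. bind_pmf (\<sigma> \<omega>) (\<pi> \<omega>))"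
    using *(2) by (auto simp: admissible_def trans_mix_iff natures_def)
  then show "Q (path_measure \<sigma> \<pi> s)"
    using * by (subst path_measure_eq_chain[OF refl]) auto
next
  fix \<kappa> assume *: "\<forall>\<pi>\<in>natures I. Q (path_measure \<sigma> \<pi> s)" "admissible I \<sigma> \<kappa>"
  have "\<forall>\<omega>. \<exists>f. \<omega> \<noteq> [] \<longrightarrow> (\<forall>a. f a \<in> Gamma I (last \<omega>) a) \<and> \<kappa> \<omega> = bind_pmf (\<sigma> \<omega>) f"
    using *(2) by (auto simp: admissible_def trans_mix_iff)
  then obtain \<pi> where \<pi>: "\<And>\<omega>. \<omega> \<noteq> [] \<Longrightarrow> (\<forall>a. \<pi> \<omega> a \<in> Gamma I (last \<omega>) a) \<and> \<kappa> \<omega> = bind_pmf (\<sigma> \<omega>) (\<pi> \<omega>)"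
    by metis
  then have "\<pi> \<in> natures I" by (auto simp: natures_def)
  then show "Q (chain \<kappa> s)" using * \<pi> path_measure_eq_chain[of \<kappa> \<sigma> \<pi>] by metis
qed

lemma expv_bind: "expv (bind_pmf \<rho> f) x = expv \<rho> (\<lambda>a. expv (f a) x)"
  unfolding expv_def pmf_bind_finite sum_distrib_right sum_distrib_left
  by (subst sum.swap) (simp add: mult.assoc)

lemma expv_bdd_below: "bdd_below ((\<lambda>\<mu>. expv \<mu> x) ` A)" for x :: "'s::finite \<Rightarrow> real"
proof (rule bdd_belowI2)
  fix \<mu> :: "'s pmf"
  have "expv \<mu> (\<lambda>_. Min (range x)) \<le> expv \<mu> x" by (rule expv_mono) simp
  then show "Min (range x) \<le> expv \<mu> x" by simp
qed

lemma buntil_prob_cong_ext: "(\<And>xs. \<kappa> (\<omega> @ xs) = \<kappa>' (\<omega> @ xs)) \<Longrightarrow> buntil_prob F G \<kappa> k \<omega> = buntil_prob F G \<kappa>' k \<omega>"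
proof (induction k arbitrary: \<omega>)
  case (Suc k)
  have "buntil_prob F G \<kappa> k (\<omega> @ [s]) = buntil_prob F G \<kappa>' k (\<omega> @ [s])" for s
    by (rule Suc.IH) (use Suc.prems[of "s # xs" for xs] in simp)
  then show ?case using Suc.prems[of "[]"] by simp
qed simp

lemma until_prob_cong_ext: "(\<And>xs. \<kappa> (\<omega> @ xs) = \<kappa>' (\<omega> @ xs)) \<Longrightarrow> until_prob F G \<kappa> \<omega> = until_prob F G \<kappa>' \<omega>"
  unfolding until_prob_def by (simp cong: buntil_prob_cong_ext)

text \<open>A nonnegative potential that does not grow in expectation dominates every bounded
  probability, by induction on the bound. The first alternative of \<open>step\<close> stops the
  induction at histories where the estimate is already known: goal states, or histories after a
  change of strategy.\<close>

lemma until_prob_le_supermartingale: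
  assumes "Inv \<omega>" and nonneg: "\<And>\<omega>. Inv \<omega> \<Longrightarrow> 0 \<le> \<Phi> \<omega>"
    and step: "\<And>\<omega>. Inv \<omega> \<Longrightarrow> until_prob F G \<kappa> \<omega> \<le> \<Phi> \<omega> \<or>
      last \<omega> \<notin> G \<and> expv (\<kappa> \<omega>) (\<lambda>s. \<Phi> (\<omega> @ [s])) \<le> \<Phi> \<omega> \<and> (\<forall>s\<in>set_pmf (\<kappa> \<omega>). Inv (\<omega> @ [s]))"
  shows "until_prob F G \<kappa> \<omega> \<le> \<Phi> \<omega>"
proof (rule until_prob_least)
  fix k show "buntil_prob F G \<kappa> k \<omega> \<le> \<Phi> \<omega>"
    using \<open>Inv \<omega>\<close>
  proof (induction k arbitrary: \<omega>)
    case (Suc k)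
    from step[OF Suc.prems] show ?case
    proof
      assume "until_prob F G \<kappa> \<omega> \<le> \<Phi> \<omega>"
      then show ?thesis using buntil_prob_le_until_prob[of F G \<kappa> "Suc k" \<omega>] by linarith
    next
      assume *: "last \<omega> \<notin> G \<and> expv (\<kappa> \<omega>) (\<lambda>s. \<Phi> (\<omega> @ [s])) \<le> \<Phi> \<omega> \<and> (\<forall>s\<in>set_pmf (\<kappa> \<omega>). Inv (\<omega> @ [s]))"
      then have "expv (\<kappa> \<omega>) (\<lambda>s. buntil_prob F G \<kappa> k (\<omega> @ [s])) \<le> expv (\<kappa> \<omega>) (\<lambda>s. \<Phi> (\<omega> @ [s]))"
        by (intro expv_mono Suc.IH) auto
      then show ?thesis using * nonneg[OF Suc.prems] by simp
    qed
  qed (simp add: nonneg)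
qed

text \<open>Because the potential is at most 1 and each undecided step carries a factor
  \<open>l\<close>, plays still undecided after \<open>k\<close> steps account for at most
  \<open>l ^ k\<close> of it. This replaces an explicit argument that the goal is eventually
  approached.\<close>

lemma until_prob_ge_discounted:
  assumes "0 \<le> l" "l < 1" "\<omega> \<noteq> []"
    and le_1: "\<And>\<omega>. \<omega> \<noteq> [] \<Longrightarrow> \<Phi> \<omega> \<le> 1"
    and fail: "\<And>\<omega>. \<omega> \<noteq> [] \<Longrightarrow> last \<omega> \<notin> G \<Longrightarrow> last \<omega> \<notin> F \<Longrightarrow> \<Phi> \<omega> \<le> 0"
    and step: "\<And>\<omega>. \<omega> \<noteq> [] \<Longrightarrow> last \<omega> \<notin> G \<Longrightarrow> last \<omega> \<in> F \<Longrightarrow> \<Phi> \<omega> \<le> l * expv (\<kappa> \<omega>) (\<lambda>s. \<Phi> (\<omega> @ [s]))"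
  shows "\<Phi> \<omega> \<le> until_prob F G \<kappa> \<omega>"
proof -
  have *: "\<Phi> \<omega> - l ^ k \<le> buntil_prob F G \<kappa> k \<omega>" if "\<omega> \<noteq> []" for k \<omega>
    using that
  proof (induction k arbitrary: \<omega>)
    case 0
    then show ?case using le_1 by simp
  next
    case (Suc k)
    have l: "0 \<le> l ^ Suc k" using assms by simp
    consider "last \<omega> \<in> G" | "last \<omega> \<notin> G" "last \<omega> \<notin> F" | "last \<omega> \<notin> G" "last \<omega> \<in> F" by blast
    then show ?case
    proof cases
      case 1
      then show ?thesis using le_1[OF Suc.prems] l by simp
    next
      case 2
      then show ?thesis using fail[OF Suc.prems] l by simp
    next
      case 3
      let ?E = "expv (\<kappa> \<omega>)"
      have "?E (\<lambda>s. \<Phi> (\<omega> @ [s]) - l ^ k) \<le> ?E (\<lambda>s. buntil_prob F G \<kappa> k (\<omega> @ [s]))"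
        by (intro expv_mono Suc.IH) simp
      then have "?E (\<lambda>s. \<Phi> (\<omega> @ [s])) - l ^ k \<le> buntil_prob F G \<kappa> (Suc k) \<omega>"
        using 3 by (simp add: expv_diff)
      then have "l * (?E (\<lambda>s. \<Phi> (\<omega> @ [s])) - l ^ k) \<le> l * buntil_prob F G \<kappa> (Suc k) \<omega>"
        using assms(1) by (rule mult_left_mono)
      also have "\<dots> \<le> buntil_prob F G \<kappa> (Suc k) \<omega>"
        using assms(1,2) buntil_prob_nonneg[of F G \<kappa> "Suc k" \<omega>] mult_right_mono[of l 1 "buntil_prob F G \<kappa> (Suc k) \<omega>"] by simp
      finally show ?thesis using step[OF Suc.prems 3] by (simp add: algebra_simps del: buntil_prob.simps)
    qed
  qed
  have "(\<lambda>k. \<Phi> \<omega> - l ^ k) \<longlonglongrightarrow> \<Phi> \<omega> - 0"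
    using assms by (intro tendsto_intros LIMSEQ_power_zero) auto
  then have "\<Phi> \<omega> - 0 \<le> until_prob F G \<kappa> \<omega>"
    by (rule LIMSEQ_le[OF _ buntil_prob_tendsto]) (use * \<open>\<omega> \<noteq> []\<close> in auto)
  then show ?thesis by simp
qed

text \<open>The defect of \<open>\<Phi>\<close> below the until probability contracts: within boundedly many steps, the rank
drops to zero with probability bounded away from zero.\<close>

lemma until_prob_ge_progress:
  fixes rk :: "'s::finite \<Rightarrow> nat"
  assumes "Inv \<omega>" and "0 < \<delta>" "\<delta> \<le> 1"
    and le_1: "\<And>\<omega>. Inv \<omega> \<Longrightarrow> \<Phi> \<omega> \<le> 1"
    and step: "\<And>\<omega>. Inv \<omega> \<Longrightarrow> \<Phi> \<omega> \<le> until_prob F G \<kappa> \<omega> \<or>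
      last \<omega> \<notin> G \<and> last \<omega> \<in> F \<and> \<Phi> \<omega> \<le> expv (\<kappa> \<omega>) (\<lambda>s. \<Phi> (\<omega> @ [s])) \<and>
      (\<forall>s\<in>set_pmf (\<kappa> \<omega>). Inv (\<omega> @ [s])) \<and> \<delta> \<le> expv (\<kappa> \<omega>) (indicator {s. rk s < rk (last \<omega>)})"
  shows "\<Phi> \<omega> \<le> until_prob F G \<kappa> \<omega>"
proof -
  define D where "D \<omega> = \<Phi> \<omega> - until_prob F G \<kappa> \<omega>" for \<omega>
  define m where "m = Max (range rk)"
  \<comment> \<open>At rank 0 the second alternative of \<open>step\<close> is impossible since
    \<open>\<delta>\<close> is positive. Hence at most \<open>m\<close> successive drops of rank,
    each of probability at least \<open>\<delta>\<close>, lead to a history without defect; the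
    exponent \<open>Suc m\<close> is a convenient weakening.\<close>
  define q where "q = 1 - \<delta> ^ Suc m"
  have contract: "D \<omega> \<le> q * B" if B: "0 \<le> B" "\<And>\<omega>. Inv \<omega> \<Longrightarrow> D \<omega> \<le> B" and "Inv \<omega>" for B \<omega>
  proof -
    have *: "D \<omega> \<le> (1 - \<delta> ^ Suc (rk (last \<omega>))) * B" if "Inv \<omega>" for \<omega>
      using that
    proof (induction "rk (last \<omega>)" arbitrary: \<omega> rule: less_induct)
      case less
      let ?i = "rk (last \<omega>)"
      have pow: "0 \<le> \<delta> ^ n" "\<delta> ^ n \<le> 1" for n using assms(2,3) by (auto intro: power_le_one)
      from step[OF less.prems] show ?case
      proof
        assume "\<Phi> \<omega> \<le> until_prob F G \<kappa> \<omega>"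
        then have "D \<omega> \<le> 0" by (simp add: D_def)
        also have "0 \<le> (1 - \<delta> ^ Suc ?i) * B" using B(1) pow by (intro mult_nonneg_nonneg) (auto simp del: power_Suc)
        finally show ?thesis .
      next
        assume s: "last \<omega> \<notin> G \<and> last \<omega> \<in> F \<and> \<Phi> \<omega> \<le> expv (\<kappa> \<omega>) (\<lambda>s. \<Phi> (\<omega> @ [s])) \<and>
          (\<forall>s\<in>set_pmf (\<kappa> \<omega>). Inv (\<omega> @ [s])) \<and> \<delta> \<le> expv (\<kappa> \<omega>) (indicator {s. rk s < ?i})"
        let ?L = "{s. rk s < ?i}"
        have "D \<omega> \<le> expv (\<kappa> \<omega>) (\<lambda>s. D (\<omega> @ [s]))"
          using s unfolding D_def expv_diff by (subst until_prob_rec) simp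
        also have "\<dots> \<le> expv (\<kappa> \<omega>) (\<lambda>s. B - \<delta> ^ ?i * B * indicator ?L s)"
        proof (rule expv_mono)
          fix s assume "s \<in> set_pmf (\<kappa> \<omega>)"
          then have inv: "Inv (\<omega> @ [s])" using s by blast
          show "D (\<omega> @ [s]) \<le> B - \<delta> ^ ?i * B * indicator ?L s"
          proof (cases "rk s < ?i")
            case True
            then have "D (\<omega> @ [s]) \<le> (1 - \<delta> ^ Suc (rk s)) * B"
              using less.hyps[of "\<omega> @ [s]"] inv by simp
            also have "\<dots> \<le> (1 - \<delta> ^ ?i) * B"
              using True assms(2,3) B(1) by (intro mult_right_mono diff_left_mono power_decreasing) auto
            finally show ?thesis using True by (simp add: algebra_simps)
          qed (use B(2)[OF inv] in simp)
        qed
        also have "\<dots> = B - \<delta> ^ ?i * B * expv (\<kappa> \<omega>) (indicator ?L)"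
          by (simp add: expv_diff expv_cmult)
        also have "\<dots> \<le> B - \<delta> ^ ?i * B * \<delta>"
          using s B(1) pow by (intro diff_left_mono mult_left_mono) auto
        finally show ?thesis by (simp add: algebra_simps)
      qed
    qed
    have "rk (last \<omega>) \<le> m" by (simp add: m_def)
    then have "(1 - \<delta> ^ Suc (rk (last \<omega>))) * B \<le> q * B"
      unfolding q_def using assms(2,3) B(1) by (intro mult_right_mono diff_left_mono power_decreasing) auto
    then show ?thesis using *[OF \<open>Inv \<omega>\<close>] by simp
  qed
  have q: "0 \<le> q" "q < 1" using assms(2,3) power_le_one[of \<delta> "Suc m"] by (auto simp: q_def)
  have bound: "Inv \<omega> \<Longrightarrow> D \<omega> \<le> q ^ n" for n \<omega>
  proof (induction n arbitrary: \<omega>)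
    case 0
    then show ?case using le_1[of \<omega>] until_prob_nonneg[of F G \<kappa> \<omega>] by (simp add: D_def)
  next
    case (Suc n)
    then show ?case using contract[of "q ^ n" \<omega>] q by simp
  qed
  have "D \<omega> \<le> 0"
    by (rule LIMSEQ_le_const[OF LIMSEQ_power_zero[of q]]) (use q bound \<open>Inv \<omega>\<close> in auto)
  then show ?thesis by (simp add: D_def)
qed

text \<open>The rank is the round in which the descending iteration from \<open>UNIV\<close> removes
  a state. States of at least that rank are still present one round earlier, so they cannot keep the
  state in. In the game this forces nature to have an answer that moves to strictly smaller
  rank.\<close>

lemma gfp_rank:
  fixes g :: "'s::finite set \<Rightarrow> 's set"
  assumes "mono g"
  shows "\<exists>r::'s \<Rightarrow> nat. \<forall>s. s \<notin> gfp g \<longrightarrow> s \<notin> g {t. t \<in> gfp g \<or> r s \<le> r t}"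
proof -
  define Y where "Y i = (g ^^ i) UNIV" for i
  have Y_Suc: "Y (Suc i) = g (Y i)" and Y_0: "Y 0 = UNIV" for i by (auto simp: Y_def)
  have dec: "Y (Suc i) \<subseteq> Y i" for i
    by (induction i) (auto simp: Y_0 Y_Suc intro: monoD[OF assms, THEN subsetD])
  have gfp_le: "gfp g \<subseteq> Y i" for i
  proof (induction i)
    case (Suc i)
    then show ?case using monoD[OF assms Suc] gfp_unfold[OF assms] by (simp add: Y_Suc)
  qed (simp add: Y_0)
  have "\<exists>m. Y (Suc m) = Y m"
  proof (rule ccontr)
    assume "\<nexists>m. Y (Suc m) = Y m"
    then have strict: "Y (Suc m) \<subset> Y m" for m using dec[of m] by blast
    have "card (Y n) + n \<le> card (UNIV :: 's set)" for n
    proof (induction n)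
      case (Suc n)
      have "card (Y (Suc n)) < card (Y n)" by (rule psubset_card_mono[OF _ strict]) simp
      then show ?case using Suc by simp
    qed (simp add: Y_0)
    from this[of "Suc (card (UNIV :: 's set))"] show False by simp
  qed
  then obtain m where "Y (Suc m) = Y m" by blast
  then have "Y m \<subseteq> gfp g" by (intro gfp_upperbound) (simp add: Y_Suc)
  then have out: "s \<notin> gfp g \<Longrightarrow> \<exists>i. s \<notin> Y i" for s by blast
  define r where "r s = (LEAST i. s \<notin> Y i)" for s
  have "s \<notin> g {t. t \<in> gfp g \<or> r s \<le> r t}" if s: "s \<notin> gfp g" for s
  proof -
    have rs: "s \<notin> Y (r s)" unfolding r_def using out[OF s] by (rule LeastI_ex)
    then obtain j where j: "r s = Suc j" using Y_0 by (cases "r s") auto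
    have "{t. t \<in> gfp g \<or> r s \<le> r t} \<subseteq> Y j"
    proof safe
      fix t assume "t \<in> gfp g" then show "t \<in> Y j" using gfp_le by blast
    next
      fix t assume "r s \<le> r t"
      then have "j < (LEAST i. t \<notin> Y i)" using j by (simp add: r_def)
      then show "t \<in> Y j" using not_less_Least by blast
    qed
    then have "g {t. t \<in> gfp g \<or> r s \<le> r t} \<subseteq> Y (r s)" using monoD[OF assms] by (simp add: j Y_Suc)
    then show ?thesis using rs by blast
  qed
  then show ?thesis by blast
qed

text \<open>Finite paths grow at the right end, so recursion along a path is recursion on the reversed list.\<close>

lemma snoc_recursion:
  "\<exists>b. (\<forall>s. b [s] = z) \<and> (\<forall>\<omega> s. \<omega> \<noteq> [] \<longrightarrow> b (\<omega> @ [s]) = g \<omega> (b \<omega>))"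
  by (rule exI[of _ "\<lambda>\<omega>. rec_list z (\<lambda>x xs r. if xs = [] then z else g (rev xs) r) (rev \<omega>)"]) auto

section \<open>Values of the until game\<close>

text \<open>The infimum need not be attained, as intervals may be open; the maximum always is. Pure
  actions suffice by \<open>le_step_value_iff_mix\<close>.\<close>

definition step_value :: "('s::finite \<Rightarrow> 'a::finite \<Rightarrow> 's \<Rightarrow> real set) \<Rightarrow> 's \<Rightarrow> ('s \<Rightarrow> real) \<Rightarrow> real" where
  "step_value I s x = Max (range (\<lambda>a. INF \<mu>\<in>Gamma I s a. expv \<mu> x))"

text \<open>The sign \<open>c\<close> is 1 if the scheduler maximises the until probability and -1 if it minimises it; in both
cases it maximises \<open>c\<close> times that probability. The factor \<open>l\<close> is a discount.\<close>

fun value_iter :: "('s::finite \<Rightarrow> 'a::finite \<Rightarrow> 's \<Rightarrow> real set) \<Rightarrow> 's set \<Rightarrow> 's set \<Rightarrow> real \<Rightarrow> real \<Rightarrow> nat \<Rightarrow> 's \<Rightarrow> real" where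
  "value_iter I F G c l 0 s = 0"
| "value_iter I F G c l (Suc n) s = (if s \<in> G then c else if s \<notin> F then 0 else l * step_value I s (value_iter I F G c l n))"

definition opt_value :: "('s::finite \<Rightarrow> 'a::finite \<Rightarrow> 's \<Rightarrow> real set) \<Rightarrow> 's set \<Rightarrow> 's set \<Rightarrow> real \<Rightarrow> real \<Rightarrow> 's \<Rightarrow> real" where
  "opt_value I F G c l s = lim (\<lambda>n. value_iter I F G c l n s)"

locale until_game =
  fixes I :: "'s::finite \<Rightarrow> 'a::finite \<Rightarrow> 's \<Rightarrow> real set"
  assumes Gamma_nonempty: "Gamma I s a \<noteq> {}"
begin

text \<open>The interface through which \<open>step_value\<close> is used: the maximum becomes a
  witness without any epsilon, and the possibly unattained infimum becomes a universal
  statement.\<close>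

lemma le_step_value_iff: "y \<le> step_value I s x \<longleftrightarrow> (\<exists>a. \<forall>\<mu>\<in>Gamma I s a. y \<le> expv \<mu> x)"
  unfolding step_value_def
  by (subst Max_ge_iff) (auto simp: le_cINF_iff[OF Gamma_nonempty expv_bdd_below])

lemma trans_mix_exists: "\<exists>\<mu>. trans_mix I s \<rho> \<mu>"
proof -
  have "\<forall>a. \<exists>\<mu>. \<mu> \<in> Gamma I s a" using Gamma_nonempty by blast
  then show ?thesis unfolding trans_mix_iff by metis
qed

lemma trans_mix_return: "trans_mix I s (return_pmf a) \<mu> \<longleftrightarrow> \<mu> \<in> Gamma I s a"
proof
  assume \<mu>: "\<mu> \<in> Gamma I s a"
  have "\<forall>a. \<exists>\<mu>. \<mu> \<in> Gamma I s a" using Gamma_nonempty by blast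
  then obtain f where f: "\<And>a. f a \<in> Gamma I s a" by metis
  show "trans_mix I s (return_pmf a) \<mu>"
    unfolding trans_mix_iff by (intro exI[of _ "f(a := \<mu>)"]) (auto simp: bind_return_pmf f \<mu>)
qed (auto simp: trans_mix_iff bind_return_pmf)

text \<open>If every pure action had an answer below \<open>y\<close>, nature could give all these
  answers at once and push any mixture strictly below \<open>y\<close>. The mixed form is the one
  that bisimulation can transfer.\<close>

lemma le_step_value_iff_mix: "y \<le> step_value I s x \<longleftrightarrow> (\<exists>\<rho>. \<forall>\<mu>. trans_mix I s \<rho> \<mu> \<longrightarrow> y \<le> expv \<mu> x)"
proof
  assume "y \<le> step_value I s x"
  then show "\<exists>\<rho>. \<forall>\<mu>. trans_mix I s \<rho> \<mu> \<longrightarrow> y \<le> expv \<mu> x"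
    unfolding le_step_value_iff by (metis trans_mix_return)
next
  assume "\<exists>\<rho>. \<forall>\<mu>. trans_mix I s \<rho> \<mu> \<longrightarrow> y \<le> expv \<mu> x"
  then obtain \<rho> where \<rho>: "\<And>\<mu>. trans_mix I s \<rho> \<mu> \<Longrightarrow> y \<le> expv \<mu> x" by blast
  show "y \<le> step_value I s x"
  proof (rule ccontr)
    assume "\<not> y \<le> step_value I s x"
    then have "\<forall>a. \<exists>\<mu>\<in>Gamma I s a. expv \<mu> x < y" unfolding le_step_value_iff by (auto simp: not_le)
    then obtain f where f: "\<And>a. f a \<in> Gamma I s a" "\<And>a. expv (f a) x < y" by metis
    obtain a where "a \<in> set_pmf \<rho>" using set_pmf_not_empty[of \<rho>] by blast
    then have "expv \<rho> (\<lambda>a. expv (f a) x) < expv \<rho> (\<lambda>_. y)"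
      using f(2) by (intro expv_strict_mono) (auto intro: less_imp_le)
    moreover have "y \<le> expv (bind_pmf \<rho> f) x" by (rule \<rho>) (use f(1) in \<open>auto simp: trans_mix_iff\<close>)
    ultimately show False by (simp add: expv_bind)
  qed
qed

lemma step_value_less_mix: "step_value I s x < y \<Longrightarrow> \<exists>\<mu>. trans_mix I s \<rho> \<mu> \<and> expv \<mu> x < y"
  using le_step_value_iff_mix[of y s x] by (metis not_le)

text \<open>One estimate serves twice: \<open>e = 0\<close> is monotonicity, and small
  \<open>e\<close> gives continuity in \<open>step_value_tendsto\<close>.\<close>

lemma step_value_le_add: "(\<And>s. x s \<le> y s + e) \<Longrightarrow> step_value I s x \<le> step_value I s y + e"
proof -
  assume xy: "\<And>s. x s \<le> y s + e"
  obtain a where a: "\<forall>\<mu>\<in>Gamma I s a. step_value I s x \<le> expv \<mu> x" using le_step_value_iff by blast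
  have "step_value I s x - e \<le> expv \<mu> y" if "\<mu> \<in> Gamma I s a" for \<mu>
    using expv_mono[of \<mu> x "\<lambda>s. y s + e"] xy a that by (simp add: expv_add) force
  then have "step_value I s x - e \<le> step_value I s y" unfolding le_step_value_iff by blast
  then show ?thesis by simp
qed

lemma step_value_mono: "(\<And>s. x s \<le> y s) \<Longrightarrow> step_value I s x \<le> step_value I s y"
  using step_value_le_add[of x y 0] by simp

lemma step_value_const: "step_value I s (\<lambda>_. y) = y"
  using le_step_value_iff[of _ s "\<lambda>_. y"] Gamma_nonempty by (auto intro!: antisym) (metis ex_in_conv order_refl)

lemma step_value_cmult: "0 \<le> k \<Longrightarrow> step_value I s (\<lambda>s. k * x s) = k * step_value I s x"
proof (cases "k = 0")
  case False
  assume "0 \<le> k"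
  then have k: "0 < k" using False by simp
  have "y \<le> step_value I s (\<lambda>s. k * x s) \<longleftrightarrow> y \<le> k * step_value I s x" for y
    using le_step_value_iff[of y s "\<lambda>s. k * x s"] le_step_value_iff[of "y / k" s x] k
    by (simp add: expv_cmult pos_divide_le_eq mult.commute)
  then show ?thesis by (meson order_antisym order_refl)
qed (simp add: step_value_const)

end

section \<open>Convergence of value iteration, with and without discount\<close>

context until_game
begin

text \<open>Multiplying by \<open>c\<close> makes both signs look alike from outside: iterates lie
  between 0 and 1 and increase. The operator itself is a maximum of infima and does not commute with
  negation, so the proofs treat the signs separately, using monotonicity in opposite
  directions.\<close>

lemma value_iter_nonneg: "0 \<le> c * value_iter I F G c l n s" if "0 \<le> l" "c = 1 \<or> c = -1"
proof (induction n arbitrary: s)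
  case (Suc n)
  have "0 \<le> c * (l * step_value I s (value_iter I F G c l n))"
    using that(2)
  proof
    assume "c = 1"
    then show ?thesis using step_value_mono[of "\<lambda>_. 0" "value_iter I F G c l n" s] Suc that(1) by (simp add: step_value_const)
  next
    assume "c = -1"
    then show ?thesis using step_value_mono[of "value_iter I F G c l n" "\<lambda>_. 0" s] Suc that(1)
      by (simp add: step_value_const mult_nonneg_nonpos)
  qed
  then show ?case using that by auto
qed simp

lemma value_iter_le_1: "c * value_iter I F G c l n s \<le> 1" if "0 \<le> l" "l \<le> 1" "c = 1 \<or> c = -1"
proof (induction n arbitrary: s)
  case (Suc n)
  have "c * step_value I s (value_iter I F G c l n) \<le> 1"
    using that(3)
  proof
    assume "c = 1"
    then show ?thesis using step_value_mono[of "value_iter I F G c l n" "\<lambda>_. 1" s] Suc by (simp add: step_value_const)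
  next
    assume "c = -1"
    then show ?thesis using step_value_mono[of "\<lambda>_. -1" "value_iter I F G c l n" s] Suc by (simp add: step_value_const)
  qed
  then have "l * (c * step_value I s (value_iter I F G c l n)) \<le> l * 1" using that(1) by (rule mult_left_mono)
  then show ?case using that by (auto simp: mult.left_commute)
qed simp

lemma value_iter_Suc_mono: "c * value_iter I F G c l n s \<le> c * value_iter I F G c l (Suc n) s" if "0 \<le> l" "c = 1 \<or> c = -1"
proof (induction n arbitrary: s)
  case 0
  then show ?case using value_iter_nonneg[OF that, of F G "Suc 0"] by (simp del: value_iter.simps(2))
next
  case (Suc n)
  have "c * (l * step_value I s (value_iter I F G c l n)) \<le> c * (l * step_value I s (value_iter I F G c l (Suc n)))"
    using that(2)
  proof
    assume "c = 1"
    then show ?thesis using step_value_mono[of "value_iter I F G c l n" "value_iter I F G c l (Suc n)" s] Suc that(1)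
      by (simp add: mult_left_mono del: value_iter.simps)
  next
    assume "c = -1"
    then show ?thesis using step_value_mono[of "value_iter I F G c l (Suc n)" "value_iter I F G c l n" s] Suc that(1)
      by (simp add: mult_left_mono del: value_iter.simps)
  qed
  then show ?case by (subst (1 2) value_iter.simps) (simp del: value_iter.simps)
qed

lemma value_iter_tendsto: "(\<lambda>n. value_iter I F G c l n s) \<longlonglongrightarrow> opt_value I F G c l s" if "0 \<le> l" "l \<le> 1" "c = 1 \<or> c = -1"
proof -
  have "incseq (\<lambda>n. c * value_iter I F G c l n s)" by (rule incseq_SucI) (rule value_iter_Suc_mono[OF that(1,3)])
  moreover have "\<forall>n. c * value_iter I F G c l n s \<le> 1" using value_iter_le_1[OF that] by blast
  ultimately have "convergent (\<lambda>n. c * value_iter I F G c l n s)"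
    unfolding convergent_def by (metis incseq_convergent)
  then have "convergent (\<lambda>n. c * (c * value_iter I F G c l n s))" by (rule convergent_mult[OF convergent_const])
  moreover have "c * (c * y) = y" for y using that(3) by auto
  ultimately show ?thesis by (simp add: opt_value_def convergent_LIMSEQ_iff)
qed

lemma opt_value_nonneg: "0 \<le> c * opt_value I F G c l s" if "0 \<le> l" "l \<le> 1" "c = 1 \<or> c = -1"
  by (rule LIMSEQ_le_const[OF tendsto_mult_left[OF value_iter_tendsto[OF that]]]) (use value_iter_nonneg[OF that(1,3)] in blast)

lemma opt_value_le_1: "c * opt_value I F G c l s \<le> 1" if "0 \<le> l" "l \<le> 1" "c = 1 \<or> c = -1"
  by (rule LIMSEQ_le_const2[OF tendsto_mult_left[OF value_iter_tendsto[OF that]]]) (use value_iter_le_1[OF that] in blast)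

lemma value_iter_le_opt_value: "c * value_iter I F G c l n s \<le> c * opt_value I F G c l s" if "0 \<le> l" "l \<le> 1" "c = 1 \<or> c = -1"
  by (rule incseq_le[OF incseq_SucI tendsto_mult_left[OF value_iter_tendsto[OF that]]]) (rule value_iter_Suc_mono[OF that(1,3)])

lemma step_value_tendsto:
  assumes "\<And>s. (\<lambda>n. x n s) \<longlonglongrightarrow> y s"
  shows "(\<lambda>n. step_value I s (x n)) \<longlonglongrightarrow> step_value I s y"
proof (rule LIMSEQ_I)
  fix e :: real assume e: "0 < e"
  have "\<forall>\<^sub>F n in sequentially. \<forall>s. dist (x n s) (y s) < e / 2"
    by (rule eventually_all_finite) (use tendstoD[OF assms, of "e/2"] e in auto)
  then obtain N where N: "\<And>n s. n \<ge> N \<Longrightarrow> \<bar>x n s - y s\<bar> < e / 2"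
    by (auto simp: eventually_sequentially dist_real_def)
  have "norm (step_value I s (x n) - step_value I s y) < e" if "n \<ge> N" for n
  proof -
    have "x n s \<le> y s + e / 2" "y s \<le> x n s + e / 2" for s using N[OF that, of s] by linarith+
    then have "step_value I s (x n) \<le> step_value I s y + e / 2" "step_value I s y \<le> step_value I s (x n) + e / 2"
      by (auto intro!: step_value_le_add)
    then show ?thesis using e by simp
  qed
  then show "\<exists>N. \<forall>n\<ge>N. norm (step_value I s (x n) - step_value I s y) < e" by blast
qed

lemma opt_value_rec:
  assumes "0 \<le> l" "l \<le> 1" "c = 1 \<or> c = -1"
  shows "opt_value I F G c l s = (if s \<in> G then c else if s \<notin> F then 0 else l * step_value I s (opt_value I F G c l))"
proof (rule LIMSEQ_unique)
  show "(\<lambda>n. value_iter I F G c l (Suc n) s) \<longlonglongrightarrow> opt_value I F G c l s"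
    using value_iter_tendsto[OF assms] by (rule LIMSEQ_Suc)
  show "(\<lambda>n. value_iter I F G c l (Suc n) s) \<longlonglongrightarrow> (if s \<in> G then c else if s \<notin> F then 0 else l * step_value I s (opt_value I F G c l))"
    by (auto intro!: tendsto_intros step_value_tendsto value_iter_tendsto assms)
qed

text \<open>A reward collected within \<open>n\<close> rounds is discounted at most \<open>n\<close>
  times.\<close>

lemma value_iter_discount:
  assumes "0 \<le> l" "l \<le> 1" "c = 1 \<or> c = -1"
  shows "l ^ n * (c * value_iter I F G c 1 n s) \<le> c * value_iter I F G c l n s"
proof (induction n arbitrary: s)
  case (Suc n)
  have pow: "l ^ k \<le> 1" for k using assms by (simp add: power_le_one)
  have "l ^ Suc n * (c * step_value I s (value_iter I F G c 1 n)) \<le> c * (l * step_value I s (value_iter I F G c l n))"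
    using assms(3)
  proof
    assume c: "c = 1"
    have "step_value I s (\<lambda>s. l ^ n * value_iter I F G c 1 n s) \<le> step_value I s (value_iter I F G c l n)"
      using Suc c by (intro step_value_mono) simp
    then show ?thesis using assms(1) c by (simp add: step_value_cmult mult_left_mono mult.assoc)
  next
    assume c: "c = -1"
    have "step_value I s (value_iter I F G c l n) \<le> step_value I s (\<lambda>s. l ^ n * value_iter I F G c 1 n s)"
      using Suc c by (intro step_value_mono) simp
    then show ?thesis using assms(1) c by (simp add: step_value_cmult mult_left_mono mult.assoc)
  qed
  then show ?case using assms pow[of "Suc n"] by (auto simp del: power_Suc)
qed simp

text \<open>The horizon \<open>n\<close> is fixed before \<open>l\<close>: finitely many states
  allow one \<open>n\<close> whose undiscounted iterate is within \<open>e / 2\<close> of the value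
  everywhere, and for \<open>l\<close> close enough to 1 the discounting of \<open>n\<close> rounds
  costs at most another \<open>e / 2\<close>.\<close>

lemma opt_value_discount:
  assumes "0 < e" "c = 1 \<or> c = -1"
  shows "\<exists>l. 0 \<le> l \<and> l < 1 \<and> (\<forall>s. c * opt_value I F G c 1 s - e \<le> c * opt_value I F G c l s)"
proof -
  have "\<forall>\<^sub>F n in sequentially. \<forall>s. dist (value_iter I F G c 1 n s) (opt_value I F G c 1 s) < e / 2"
    by (rule eventually_all_finite) (use tendstoD[OF value_iter_tendsto, of 1 c "e/2"] assms in auto)
  then obtain n where n: "\<And>s. \<bar>value_iter I F G c 1 n s - opt_value I F G c 1 s\<bar> < e / 2"
    by (auto simp: eventually_sequentially dist_real_def)
  have "((\<lambda>l::real. l ^ n) \<longlongrightarrow> 1 ^ n) (at_left 1)" by (intro tendsto_intros)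
  then have "\<forall>\<^sub>F l in at_left 1. 1 - e / 2 < l ^ n" using assms(1) by (intro order_tendstoD) auto
  moreover have "\<forall>\<^sub>F l in at_left (1::real). l \<in> {0<..<1}" by (rule eventually_at_leftI[of 0]) auto
  ultimately have "\<forall>\<^sub>F l in at_left (1::real). 1 - e / 2 < l ^ n \<and> l \<in> {0<..<1}" by (rule eventually_conj)
  then obtain l :: real where l: "1 - e / 2 < l ^ n" "0 < l" "l < 1"
    using eventually_happens'[of "at_left (1::real)"] by (auto simp: trivial_limit_at_left_real)
  have "c * opt_value I F G c 1 s - e \<le> c * opt_value I F G c l s" for s
  proof -
    have b: "c * value_iter I F G c 1 n s \<le> 1" "0 \<le> c * value_iter I F G c 1 n s"
      using value_iter_le_1[of 1 c] value_iter_nonneg[of 1 c] assms(2) by auto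
    have "c * opt_value I F G c 1 s - e / 2 \<le> c * value_iter I F G c 1 n s"
    proof -
      have "c * opt_value I F G c 1 s - c * value_iter I F G c 1 n s \<le> \<bar>value_iter I F G c 1 n s - opt_value I F G c 1 s\<bar>"
        using assms(2) by auto
      then show ?thesis using n[of s] by linarith
    qed
    also have "\<dots> - e / 2 \<le> l ^ n * (c * value_iter I F G c 1 n s)"
    proof -
      have "(1 - l ^ n) * (c * value_iter I F G c 1 n s) \<le> e / 2 * 1"
        using l b assms(1) by (intro mult_mono) auto
      then show ?thesis by (simp add: algebra_simps)
    qed
    also have "\<dots> \<le> c * value_iter I F G c l n s" by (rule value_iter_discount) (use l assms in auto)
    also have "\<dots> \<le> c * opt_value I F G c l s" by (rule value_iter_le_opt_value) (use l assms in auto)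
    finally show ?thesis by simp
  qed
  then show ?thesis using l by (intro exI[of _ l]) auto
qed

section \<open>Optimal schedulers and nearly optimal answers of nature\<close>

lemma opt_action: "\<exists>f. \<forall>s. \<forall>\<mu>\<in>Gamma I s (f s). step_value I s x \<le> expv \<mu> x"
proof -
  have "\<forall>s. \<exists>a. \<forall>\<mu>\<in>Gamma I s a. step_value I s x \<le> expv \<mu> x" using le_step_value_iff by blast
  then show ?thesis by metis
qed

lemma admissible_positional:
  "admissible I (\<lambda>\<omega>. return_pmf (f (last \<omega>))) \<kappa> \<Longrightarrow> \<omega> \<noteq> [] \<Longrightarrow> \<kappa> \<omega> \<in> Gamma I (last \<omega>) (f (last \<omega>))"
  by (auto simp: admissible_def trans_mix_return)

text \<open>There are finitely many positional choices, so one of them is optimal for discount factors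
arbitrarily close to 1.\<close>

lemma scheduler_optimal_max:
  "\<exists>\<sigma>. \<forall>\<kappa>. admissible I \<sigma> \<kappa> \<longrightarrow> (\<forall>\<omega>. \<omega> \<noteq> [] \<longrightarrow> opt_value I F G 1 1 (last \<omega>) \<le> until_prob F G \<kappa> \<omega>)"
proof -
  let ?v = "\<lambda>l. opt_value I F G 1 l"
  define good where "good f l \<longleftrightarrow> (\<forall>s. \<forall>\<mu>\<in>Gamma I s (f s). step_value I s (?v l) \<le> expv \<mu> (?v l))" for f l
  have "\<exists>f. \<forall>e>0. \<exists>l. 0 \<le> l \<and> l < 1 \<and> good f l \<and> (\<forall>s. ?v 1 s - e \<le> ?v l s)"
  proof (rule ccontr)
    assume "\<not> ?thesis"
    then have "\<forall>f. \<exists>e>0. \<forall>l. 0 \<le> l \<longrightarrow> l < 1 \<longrightarrow> good f l \<longrightarrow> \<not> (\<forall>s. ?v 1 s - e \<le> ?v l s)" by blast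
    then obtain e where e: "\<And>f. 0 < e f"
      "\<And>f l. 0 \<le> l \<Longrightarrow> l < 1 \<Longrightarrow> good f l \<Longrightarrow> \<not> (\<forall>s. ?v 1 s - e f \<le> ?v l s)" by metis
    \<comment> \<open>The smallest of the finitely many margins is still positive. A discount factor
      within it has some optimal positional choice \<open>f\<close>, which contradicts the margin
      \<open>e f\<close> assigned to that very choice.\<close>
    have "0 < Min (range e)" using e(1) by simp
    from opt_value_discount[OF this, of 1 F G] obtain l where l: "0 \<le> l" "l < 1" "\<And>s. ?v 1 s - Min (range e) \<le> ?v l s"
      by auto
    obtain f where "good f l" using opt_action[of "?v l"] by (auto simp: good_def)
    from e(2)[OF l(1,2) this] show False using l(3) Min_le[of "range e" "e f"]
      by (metis diff_left_mono finite finite_imageI order_trans rangeI)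
  qed
  then obtain f where f: "\<And>e. 0 < e \<Longrightarrow> \<exists>l. 0 \<le> l \<and> l < 1 \<and> good f l \<and> (\<forall>s. ?v 1 s - e \<le> ?v l s)" by blast
  have "?v 1 (last \<omega>) \<le> until_prob F G \<kappa> \<omega>"
    if \<kappa>: "admissible I (\<lambda>\<omega>. return_pmf (f (last \<omega>))) \<kappa>" and \<omega>: "\<omega> \<noteq> []" for \<kappa> \<omega>
  proof (rule field_le_epsilon)
    fix e :: real assume "0 < e"
    then obtain l where l: "0 \<le> l" "l < 1" "good f l" "\<And>s. ?v 1 s - e \<le> ?v l s" using f by blast
    have "?v l (last \<omega>) \<le> until_prob F G \<kappa> \<omega>"
    proof (rule until_prob_ge_discounted[OF l(1,2) \<omega>])
      fix \<omega> :: "'s list" assume \<omega>: "\<omega> \<noteq> []"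
      show "?v l (last \<omega>) \<le> 1" using opt_value_le_1[of l 1 F G "last \<omega>"] l by simp
      show "?v l (last \<omega>) \<le> 0" if "last \<omega> \<notin> G" "last \<omega> \<notin> F"
        using opt_value_rec[of l 1 F G "last \<omega>"] l that by simp
      show "?v l (last \<omega>) \<le> l * expv (\<kappa> \<omega>) (\<lambda>s. ?v l (last (\<omega> @ [s])))" if "last \<omega> \<notin> G" "last \<omega> \<in> F"
      proof -
        have "step_value I (last \<omega>) (?v l) \<le> expv (\<kappa> \<omega>) (?v l)"
          using l(3) admissible_positional[OF \<kappa> \<omega>] by (auto simp: good_def)
        then show ?thesis using opt_value_rec[of l 1 F G "last \<omega>"] l that by (simp add: mult_left_mono)
      qed
    qed
    then show "?v 1 (last \<omega>) \<le> until_prob F G \<kappa> \<omega> + e" using l(4)[of "last \<omega>"] by linarith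
  qed
  then show ?thesis by blast
qed

text \<open>Here an optimal choice for the undiscounted step is enough: the negated value is a
  nonnegative supermartingale, and a play that never ends favours the minimiser.\<close>

lemma scheduler_optimal_min:
  "\<exists>\<sigma>. \<forall>\<kappa>. admissible I \<sigma> \<kappa> \<longrightarrow> (\<forall>\<omega>. \<omega> \<noteq> [] \<longrightarrow> opt_value I F G (-1) 1 (last \<omega>) \<le> - until_prob F G \<kappa> \<omega>)"
proof -
  let ?v = "opt_value I F G (-1) 1"
  obtain f where f: "\<And>s \<mu>. \<mu> \<in> Gamma I s (f s) \<Longrightarrow> step_value I s ?v \<le> expv \<mu> ?v" using opt_action by metis
  have "until_prob F G \<kappa> \<omega> \<le> - ?v (last \<omega>)"
    if \<kappa>: "admissible I (\<lambda>\<omega>. return_pmf (f (last \<omega>))) \<kappa>" and \<omega>: "\<omega> \<noteq> []" for \<kappa> \<omega>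
  proof (rule until_prob_le_supermartingale[where Inv="\<lambda>\<omega>. \<omega> \<noteq> []" and \<Phi>="\<lambda>\<omega>. - ?v (last \<omega>)", OF \<omega>])
    fix \<omega> :: "'s list" assume \<omega>: "\<omega> \<noteq> []"
    show "0 \<le> - ?v (last \<omega>)" using opt_value_nonneg[of 1 "-1" F G] by simp
    show "until_prob F G \<kappa> \<omega> \<le> - ?v (last \<omega>) \<or> last \<omega> \<notin> G \<and>
       expv (\<kappa> \<omega>) (\<lambda>s. - ?v (last (\<omega> @ [s]))) \<le> - ?v (last \<omega>) \<and> (\<forall>s\<in>set_pmf (\<kappa> \<omega>). \<omega> @ [s] \<noteq> [])"
    proof (cases "last \<omega> \<notin> G \<and> last \<omega> \<in> F")
      case True
      then have "?v (last \<omega>) \<le> expv (\<kappa> \<omega>) ?v"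
        using f[OF admissible_positional[OF \<kappa> \<omega>]] opt_value_rec[of 1 "-1" F G "last \<omega>"] by simp
      then show ?thesis using True by (simp add: expv_minus)
    next
      case False
      then show ?thesis using opt_value_rec[of 1 "-1" F G "last \<omega>"] by (subst until_prob_rec) auto
    qed
  qed
  then have "?v (last \<omega>) \<le> - until_prob F G \<kappa> \<omega>"
    if "admissible I (\<lambda>\<omega>. return_pmf (f (last \<omega>))) \<kappa>" "\<omega> \<noteq> []" for \<kappa> \<omega>
    using that by (metis le_minus_iff)
  then show ?thesis by blast
qed

lemma scheduler_optimal:
  assumes "c = 1 \<or> c = -1"
  shows "\<exists>\<sigma>. \<forall>\<kappa>. admissible I \<sigma> \<kappa> \<longrightarrow> (\<forall>\<omega>. \<omega> \<noteq> [] \<longrightarrow> opt_value I F G c 1 (last \<omega>) \<le> c * until_prob F G \<kappa> \<omega>)"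
  using assms
proof
  assume "c = 1" then show ?thesis using scheduler_optimal_max[of F G] by simp
next
  assume "c = -1" then show ?thesis using scheduler_optimal_min[of F G] by simp
qed

lemma nature_approx_min:
  assumes e: "0 < e"
  shows "\<exists>\<kappa>. admissible I \<sigma> \<kappa> \<and> (\<forall>\<omega>. \<omega> \<noteq> [] \<longrightarrow> until_prob F G \<kappa> \<omega> \<le> opt_value I F G 1 1 (last \<omega>) + e)"
proof -
  \<comment> \<open>The budget of a history halves with each step: one half pays for the unattained
    infimum now, the other half is the budget of every successor.\<close>
  let ?v = "opt_value I F G 1 1" and ?b = "\<lambda>\<omega>::'s list. e / 2 ^ length \<omega>"
  have "\<exists>\<mu>. trans_mix I (last \<omega>) (\<sigma> \<omega>) \<mu> \<and> expv \<mu> ?v < step_value I (last \<omega>) ?v + ?b \<omega> / 2" for \<omega>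
    using e by (intro step_value_less_mix) simp
  then obtain \<kappa> where \<kappa>: "\<And>\<omega>. trans_mix I (last \<omega>) (\<sigma> \<omega>) (\<kappa> \<omega>)"
    "\<And>\<omega>. expv (\<kappa> \<omega>) ?v < step_value I (last \<omega>) ?v + ?b \<omega> / 2" by metis
  have "until_prob F G \<kappa> \<omega> \<le> ?v (last \<omega>) + ?b \<omega>" if "\<omega> \<noteq> []" for \<omega>
  proof (rule until_prob_le_supermartingale[where Inv="\<lambda>\<omega>. \<omega> \<noteq> []", OF that])
    fix \<omega> :: "'s list" assume \<omega>: "\<omega> \<noteq> []"
    show "0 \<le> ?v (last \<omega>) + ?b \<omega>" using opt_value_nonneg[of 1 1 F G "last \<omega>"] e by simp
    show "until_prob F G \<kappa> \<omega> \<le> ?v (last \<omega>) + ?b \<omega> \<or> last \<omega> \<notin> G \<and>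
       expv (\<kappa> \<omega>) (\<lambda>s. ?v (last (\<omega> @ [s])) + ?b (\<omega> @ [s])) \<le> ?v (last \<omega>) + ?b \<omega> \<and> (\<forall>s\<in>set_pmf (\<kappa> \<omega>). \<omega> @ [s] \<noteq> [])"
    proof (cases "last \<omega> \<notin> G \<and> last \<omega> \<in> F")
      case True
      then show ?thesis
        using \<kappa>(2)[of \<omega>] opt_value_rec[of 1 1 F G "last \<omega>"] by (simp add: expv_add)
    next
      case False
      then show ?thesis using opt_value_rec[of 1 1 F G "last \<omega>"] e by (subst until_prob_rec) auto
    qed
  qed
  moreover have "?b \<omega> \<le> e" for \<omega> using e by (simp add: divide_le_eq)
  ultimately have "until_prob F G \<kappa> \<omega> \<le> ?v (last \<omega>) + e" if "\<omega> \<noteq> []" for \<omega>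
    using that by (meson add_left_mono order_trans)
  then show ?thesis using \<kappa>(1) unfolding admissible_def by blast
qed

text \<open>Nature is now the player who has to reach the goal, so it answers nearly optimally for a
  discounted value close to the true one. Half of \<open>e\<close> pays for the discount, half for
  the inexact answers.\<close>

lemma nature_approx_max:
  assumes e: "0 < e"
  shows "\<exists>\<kappa>. admissible I \<sigma> \<kappa> \<and> (\<forall>\<omega>. \<omega> \<noteq> [] \<longrightarrow> - until_prob F G \<kappa> \<omega> \<le> opt_value I F G (-1) 1 (last \<omega>) + e)"
proof -
  let ?v = "\<lambda>l. opt_value I F G (-1) l"
  obtain l where l: "0 \<le> l" "l < 1" "\<And>s. - ?v 1 s - e / 2 \<le> - ?v l s"
    using opt_value_discount[of "e / 2" "-1" F G] e by auto
  define d where "d = e / 2"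
  \<comment> \<open>The potential below is shifted down by the constant \<open>d\<close>.
    Discounting shrinks the shift to \<open>l * d\<close> after one step, and the difference
    \<open>d * (1 - l)\<close> is the error allowed in each step.\<close>
  have "\<exists>\<mu>. trans_mix I (last \<omega>) (\<sigma> \<omega>) \<mu> \<and> expv \<mu> (?v l) < step_value I (last \<omega>) (?v l) + d * (1 - l)" for \<omega>
    using e l by (intro step_value_less_mix) (simp add: d_def)
  then obtain \<kappa> where \<kappa>: "\<And>\<omega>. trans_mix I (last \<omega>) (\<sigma> \<omega>) (\<kappa> \<omega>)"
    "\<And>\<omega>. expv (\<kappa> \<omega>) (?v l) < step_value I (last \<omega>) (?v l) + d * (1 - l)" by metis
  have "- ?v l (last \<omega>) - d \<le> until_prob F G \<kappa> \<omega>" if "\<omega> \<noteq> []" for \<omega>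
  proof (rule until_prob_ge_discounted[OF l(1,2) that])
    fix \<omega> :: "'s list" assume \<omega>: "\<omega> \<noteq> []"
    show "- ?v l (last \<omega>) - d \<le> 1" using opt_value_le_1[of l "-1" F G "last \<omega>"] l e by (simp add: d_def)
    show "- ?v l (last \<omega>) - d \<le> 0" if "last \<omega> \<notin> G" "last \<omega> \<notin> F"
      using opt_value_rec[of l "-1" F G "last \<omega>"] l that e by (simp add: d_def)
    show "- ?v l (last \<omega>) - d \<le> l * expv (\<kappa> \<omega>) (\<lambda>s. - ?v l (last (\<omega> @ [s])) - d)" if "last \<omega> \<notin> G" "last \<omega> \<in> F"
    proof -
      have "l * (expv (\<kappa> \<omega>) (?v l)) \<le> l * (step_value I (last \<omega>) (?v l) + d * (1 - l))"
        using \<kappa>(2)[of \<omega>] l(1) by (intro mult_left_mono) auto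
      moreover have "l * (d * (1 - l)) \<le> 1 * (d * (1 - l))"
        using l e by (intro mult_right_mono) (auto simp: d_def)
      ultimately show ?thesis
        using opt_value_rec[of l "-1" F G "last \<omega>"] l that by (simp add: expv_diff expv_minus algebra_simps)
    qed
  qed
  then have "- until_prob F G \<kappa> \<omega> \<le> ?v 1 (last \<omega>) + e" if "\<omega> \<noteq> []" for \<omega>
    using l(3)[of "last \<omega>"] that unfolding d_def by (smt (verit) field_sum_of_halves)
  then show ?thesis using \<kappa>(1) by (auto simp: admissible_def)
qed

lemma nature_approx:
  assumes "0 < e" "c = 1 \<or> c = -1"
  shows "\<exists>\<kappa>. admissible I \<sigma> \<kappa> \<and> (\<forall>\<omega>. \<omega> \<noteq> [] \<longrightarrow> c * until_prob F G \<kappa> \<omega> \<le> opt_value I F G c 1 (last \<omega>) + e)"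
  using assms(2)
proof
  assume "c = 1" then show ?thesis using nature_approx_min[OF assms(1), of \<sigma> F G] by simp
next
  assume "c = -1" then show ?thesis using nature_approx_max[OF assms(1), of \<sigma> F G] by simp
qed

end

section \<open>Strict thresholds\<close>

text \<open>The scheduler wins strictly at a state if some choice makes every answer of nature either raise the
expected value, or preserve it and move to a strictly winning state with positive probability. If
the scheduler minimises, it also wins by trapping nature in \<open>Y\<close>, where the goal is never reached
although the value is nonzero.\<close>

definition win_step_max :: "('s::finite \<Rightarrow> 'a::finite \<Rightarrow> 's \<Rightarrow> real set) \<Rightarrow> 's set \<Rightarrow> 's set \<Rightarrow> 's set \<Rightarrow> 's set" where
  "win_step_max I F G X = {s. s \<notin> G \<and> s \<in> F \<and> (\<exists>\<rho>. \<forall>\<mu>. trans_mix I s \<rho> \<mu> \<longrightarrow>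
      opt_value I F G 1 1 s < expv \<mu> (opt_value I F G 1 1) \<or>
      opt_value I F G 1 1 s = expv \<mu> (opt_value I F G 1 1) \<and> set_pmf \<mu> \<inter> X \<noteq> {})}"

definition win_step_min :: "('s::finite \<Rightarrow> 'a::finite \<Rightarrow> 's \<Rightarrow> real set) \<Rightarrow> 's set \<Rightarrow> 's set \<Rightarrow> 's set \<Rightarrow> 's set \<Rightarrow> 's set" where
  "win_step_min I F G X Y = {s. s \<notin> G \<and> s \<in> F \<and> opt_value I F G (-1) 1 s < 0 \<and> (\<exists>\<rho>. \<forall>\<mu>. trans_mix I s \<rho> \<mu> \<longrightarrow>
      opt_value I F G (-1) 1 s < expv \<mu> (opt_value I F G (-1) 1) \<or>
      opt_value I F G (-1) 1 s = expv \<mu> (opt_value I F G (-1) 1) \<and> (set_pmf \<mu> \<inter> X \<noteq> {} \<or> set_pmf \<mu> \<subseteq> Y))}"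

text \<open>It settles the borderline case of a strict threshold equal to the value; away from the
  value, \<open>opt_value\<close> alone decides (\<open>forces_gt_iff\<close>).\<close>

definition strict_win :: "('s::finite \<Rightarrow> 'a::finite \<Rightarrow> 's \<Rightarrow> real set) \<Rightarrow> 's set \<Rightarrow> 's set \<Rightarrow> real \<Rightarrow> 's set" where
  "strict_win I F G c = {s. \<exists>\<sigma>. \<forall>\<kappa>. admissible I \<sigma> \<kappa> \<longrightarrow> opt_value I F G c 1 s < c * until_prob F G \<kappa> [s]}"

lemma mono_win_step_max: "mono (win_step_max I F G)"
proof (rule monoI)
  fix X X' :: "'a set" assume "X \<subseteq> X'"
  then have "set_pmf \<mu> \<inter> X \<noteq> {} \<Longrightarrow> set_pmf \<mu> \<inter> X' \<noteq> {}" for \<mu> by blast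
  then show "win_step_max I F G X \<subseteq> win_step_max I F G X'" unfolding win_step_max_def by fast
qed

lemma win_step_min_mono: "X \<subseteq> X' \<Longrightarrow> Y \<subseteq> Y' \<Longrightarrow> win_step_min I F G X Y \<subseteq> win_step_min I F G X' Y'"
proof -
  assume "X \<subseteq> X'" "Y \<subseteq> Y'"
  then have "set_pmf \<mu> \<inter> X \<noteq> {} \<or> set_pmf \<mu> \<subseteq> Y \<Longrightarrow> set_pmf \<mu> \<inter> X' \<noteq> {} \<or> set_pmf \<mu> \<subseteq> Y'" for \<mu> by blast
  then show ?thesis unfolding win_step_min_def by fast
qed

lemma mono_win_step_min: "mono (win_step_min I F G X)"
  by (rule monoI) (rule win_step_min_mono, auto)

lemma mono_gfp_win_step_min: "mono (\<lambda>X. gfp (win_step_min I F G X))"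
  by (rule monoI) (rule gfp_mono, auto intro: win_step_min_mono[THEN subsetD])

context until_game
begin

lemma admissible_exists: "\<exists>\<kappa>. admissible I \<sigma> \<kappa>"
proof -
  have "\<forall>\<omega>. \<exists>\<mu>. trans_mix I (last \<omega>) (\<sigma> \<omega>) \<mu>" using trans_mix_exists by blast
  then show ?thesis unfolding admissible_def by metis
qed

text \<open>What remains of a play after the prefix \<open>xs\<close> is a play against the
  scheduler that has forgotten \<open>xs\<close>. Only histories that start at \<open>s\<close> are
  constrained, so the others are filled in from an arbitrary admissible kernel.\<close>

lemma admissible_cut:
  assumes "\<And>\<omega>. \<omega> \<noteq> [] \<Longrightarrow> hd \<omega> = s \<Longrightarrow> trans_mix I (last \<omega>) (\<sigma> \<omega>) (\<kappa> (xs @ \<omega>))"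
  shows "\<exists>\<kappa>'. admissible I \<sigma> \<kappa>' \<and> (\<forall>F G k. buntil_prob F G \<kappa>' k [s] = buntil_prob F G \<kappa> k (xs @ [s])) \<and>
    (\<forall>F G. until_prob F G \<kappa>' [s] = until_prob F G \<kappa> (xs @ [s]))"
proof -
  obtain \<kappa>0 where \<kappa>0: "admissible I \<sigma> \<kappa>0" using admissible_exists by blast
  define \<kappa>' where "\<kappa>' \<omega> = (if hd \<omega> = s then \<kappa> (xs @ \<omega>) else \<kappa>0 \<omega>)" for \<omega>
  have "admissible I \<sigma> \<kappa>'" using \<kappa>0 assms by (auto simp: admissible_def \<kappa>'_def)
  moreover have *: "buntil_prob F G \<kappa>' k [s] = buntil_prob F G \<kappa> k (xs @ [s])" for F G k
    by (subst buntil_prob_append, simp) (rule buntil_prob_cong_ext, simp add: \<kappa>'_def)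
  ultimately show ?thesis by (auto simp: until_prob_def)
qed

text \<open>After one use of \<open>\<rho>\<close>, play strictly better than the value where that
  is possible and optimally elsewhere. A single strictly winning successor of positive mass makes
  the expectation strict. That optimal schedulers exist matters: an epsilon-loss elsewhere could
  consume the gain.\<close>

lemma scheduler_strict_win_max: "lfp (win_step_max I F G) \<subseteq> strict_win I F G 1"
proof (rule lfp_induct[OF mono_win_step_max])
  let ?v = "opt_value I F G 1 1"
  show "win_step_max I F G (lfp (win_step_max I F G) \<inter> strict_win I F G 1) \<subseteq> strict_win I F G 1"
  proof
    fix s assume "s \<in> win_step_max I F G (lfp (win_step_max I F G) \<inter> strict_win I F G 1)"
    then obtain \<rho> where s: "s \<notin> G" "s \<in> F" and \<rho>: "\<And>\<mu>. trans_mix I s \<rho> \<mu> \<Longrightarrow>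
        ?v s < expv \<mu> ?v \<or> ?v s = expv \<mu> ?v \<and> set_pmf \<mu> \<inter> strict_win I F G 1 \<noteq> {}"
      unfolding win_step_max_def by fast
    obtain \<sigma>0 where \<sigma>0: "\<And>\<kappa> \<omega>. admissible I \<sigma>0 \<kappa> \<Longrightarrow> \<omega> \<noteq> [] \<Longrightarrow> ?v (last \<omega>) \<le> until_prob F G \<kappa> \<omega>"
      using scheduler_optimal_max by blast
    have "\<forall>t. \<exists>\<sigma>. (\<forall>\<kappa>. admissible I \<sigma> \<kappa> \<longrightarrow> ?v t \<le> until_prob F G \<kappa> [t]) \<and>
      (t \<in> strict_win I F G 1 \<longrightarrow> (\<forall>\<kappa>. admissible I \<sigma> \<kappa> \<longrightarrow> ?v t < until_prob F G \<kappa> [t]))"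
    proof
      fix t show "\<exists>\<sigma>. (\<forall>\<kappa>. admissible I \<sigma> \<kappa> \<longrightarrow> ?v t \<le> until_prob F G \<kappa> [t]) \<and>
        (t \<in> strict_win I F G 1 \<longrightarrow> (\<forall>\<kappa>. admissible I \<sigma> \<kappa> \<longrightarrow> ?v t < until_prob F G \<kappa> [t]))"
      proof (cases "t \<in> strict_win I F G 1")
        case True
        then obtain \<sigma> where "\<And>\<kappa>. admissible I \<sigma> \<kappa> \<Longrightarrow> ?v t < until_prob F G \<kappa> [t]" by (auto simp: strict_win_def)
        then show ?thesis using less_imp_le by blast
      next
        case False
        then show ?thesis using \<sigma>0[of _ "[t]"] by auto
      qed
    qed
    then obtain \<tau> where \<tau>: "\<And>t \<kappa>. admissible I (\<tau> t) \<kappa> \<Longrightarrow> ?v t \<le> until_prob F G \<kappa> [t]"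
      "\<And>t \<kappa>. t \<in> strict_win I F G 1 \<Longrightarrow> admissible I (\<tau> t) \<kappa> \<Longrightarrow> ?v t < until_prob F G \<kappa> [t]" by metis
    \<comment> \<open>\<open>tl \<omega>\<close> is the history after the first move, and its head
      selects the continuation.\<close>
    define \<sigma> where "\<sigma> \<omega> = (if tl \<omega> = [] then \<rho> else \<tau> (hd (tl \<omega>)) (tl \<omega>))" for \<omega>
    have "?v s < 1 * until_prob F G \<kappa> [s]" if \<kappa>: "admissible I \<sigma> \<kappa>" for \<kappa>
    proof -
      have tm: "trans_mix I s \<rho> (\<kappa> [s])" using \<kappa>[unfolded admissible_def, rule_format, of "[s]"] by (simp add: \<sigma>_def)
      have "\<exists>\<kappa>'. admissible I (\<tau> t) \<kappa>' \<and> until_prob F G \<kappa>' [t] = until_prob F G \<kappa> [s, t]" for t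
      proof -
        have "trans_mix I (last \<omega>) (\<tau> t \<omega>) (\<kappa> ([s] @ \<omega>))" if "\<omega> \<noteq> []" "hd \<omega> = t" for \<omega>
          using \<kappa>[unfolded admissible_def, rule_format, of "s # \<omega>"] that by (simp add: \<sigma>_def)
        from admissible_cut[of t "\<tau> t" \<kappa> "[s]", OF this] show ?thesis by auto
      qed
      then have ge: "?v t \<le> until_prob F G \<kappa> [s, t]" "t \<in> strict_win I F G 1 \<Longrightarrow> ?v t < until_prob F G \<kappa> [s, t]" for t
        using \<tau> by metis+
      have R: "until_prob F G \<kappa> [s] = expv (\<kappa> [s]) (\<lambda>t. until_prob F G \<kappa> [s, t])" using s by (subst until_prob_rec) simp
      have le: "expv (\<kappa> [s]) ?v \<le> until_prob F G \<kappa> [s]" unfolding R by (rule expv_mono) (rule ge)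
      from \<rho>[OF tm] show ?thesis
      proof
        assume "?v s = expv (\<kappa> [s]) ?v \<and> set_pmf (\<kappa> [s]) \<inter> strict_win I F G 1 \<noteq> {}"
        then obtain t where t: "?v s = expv (\<kappa> [s]) ?v" "t \<in> set_pmf (\<kappa> [s])" "t \<in> strict_win I F G 1" by blast
        have "expv (\<kappa> [s]) ?v < until_prob F G \<kappa> [s]" unfolding R
          by (rule expv_strict_mono[of _ _ _ t]) (use ge t in auto)
        then show ?thesis using t by simp
      qed (use le in simp)
    qed
    then show "s \<in> strict_win I F G 1" unfolding strict_win_def by blast
  qed
qed

text \<open>The scheduler stays in \<open>V\<close> with the trapping choices and switches to a winning or an optimal
scheduler at the first state outside of \<open>V\<close>, which \<open>dropWhile\<close> finds in the history.\<close>

lemma scheduler_strict_win_min: "lfp (\<lambda>X. gfp (win_step_min I F G X)) \<subseteq> strict_win I F G (-1)"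
proof (rule lfp_induct[OF mono_gfp_win_step_min])
  let ?v = "opt_value I F G (-1) 1"
  define W where "W = lfp (\<lambda>X. gfp (win_step_min I F G X)) \<inter> strict_win I F G (-1)"
  define Y where "Y = gfp (win_step_min I F G W)"
  have Y_unfold: "Y = win_step_min I F G W Y" unfolding Y_def by (rule gfp_unfold[OF mono_win_step_min])
  have "\<forall>s. \<exists>\<rho>. s \<in> Y \<longrightarrow> s \<notin> G \<and> s \<in> F \<and> ?v s < 0 \<and> (\<forall>\<mu>. trans_mix I s \<rho> \<mu> \<longrightarrow>
      ?v s < expv \<mu> ?v \<or> ?v s = expv \<mu> ?v \<and> (set_pmf \<mu> \<inter> W \<noteq> {} \<or> set_pmf \<mu> \<subseteq> Y))"
    using Y_unfold unfolding win_step_min_def by blast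
  then obtain \<rho> where Y: "\<And>s. s \<in> Y \<Longrightarrow> s \<notin> G" "\<And>s. s \<in> Y \<Longrightarrow> s \<in> F" "\<And>s. s \<in> Y \<Longrightarrow> ?v s < 0"
    and \<rho>: "\<And>s \<mu>. s \<in> Y \<Longrightarrow> trans_mix I s (\<rho> s) \<mu> \<Longrightarrow>
      ?v s < expv \<mu> ?v \<or> ?v s = expv \<mu> ?v \<and> (set_pmf \<mu> \<inter> W \<noteq> {} \<or> set_pmf \<mu> \<subseteq> Y)" by metis
  obtain \<sigma>0 where \<sigma>0: "\<And>\<kappa> \<omega>. admissible I \<sigma>0 \<kappa> \<Longrightarrow> \<omega> \<noteq> [] \<Longrightarrow> ?v (last \<omega>) \<le> - until_prob F G \<kappa> \<omega>"
    using scheduler_optimal_min by blast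
  have "\<forall>t. \<exists>\<sigma>. (\<forall>\<kappa>. admissible I \<sigma> \<kappa> \<longrightarrow> until_prob F G \<kappa> [t] \<le> - ?v t) \<and>
    (t \<in> W \<longrightarrow> (\<forall>\<kappa>. admissible I \<sigma> \<kappa> \<longrightarrow> until_prob F G \<kappa> [t] < - ?v t))"
  proof
    fix t show "\<exists>\<sigma>. (\<forall>\<kappa>. admissible I \<sigma> \<kappa> \<longrightarrow> until_prob F G \<kappa> [t] \<le> - ?v t) \<and>
      (t \<in> W \<longrightarrow> (\<forall>\<kappa>. admissible I \<sigma> \<kappa> \<longrightarrow> until_prob F G \<kappa> [t] < - ?v t))"
    proof (cases "t \<in> W")
      case True
      then obtain \<sigma> where "\<And>\<kappa>. admissible I \<sigma> \<kappa> \<Longrightarrow> ?v t < -1 * until_prob F G \<kappa> [t]" by (auto simp: strict_win_def W_def)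
      then have "until_prob F G \<kappa> [t] < - ?v t" if "admissible I \<sigma> \<kappa>" for \<kappa> using that by fastforce
      then show ?thesis using less_imp_le by blast
    next
      case False
      have "until_prob F G \<kappa> [t] \<le> - ?v t" if "admissible I \<sigma>0 \<kappa>" for \<kappa> using \<sigma>0[OF that, of "[t]"] by simp
      then show ?thesis using False by blast
    qed
  qed
  then obtain \<tau> where \<tau>: "\<And>t \<kappa>. admissible I (\<tau> t) \<kappa> \<Longrightarrow> until_prob F G \<kappa> [t] \<le> - ?v t"
    "\<And>t \<kappa>. t \<in> W \<Longrightarrow> admissible I (\<tau> t) \<kappa> \<Longrightarrow> until_prob F G \<kappa> [t] < - ?v t" by metis
  define V where "V = Y - W"
  define \<sigma> where "\<sigma> \<omega> = (let d = dropWhile (\<lambda>s. s \<in> V) \<omega> in if d = [] then \<rho> (last \<omega>) else \<tau> (hd d) d)" for \<omega>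
  have strict_win_V: "s \<in> strict_win I F G (-1)" if s: "s \<in> V" for s
  proof -
    have "?v s < -1 * until_prob F G \<kappa> [s]" if \<kappa>: "admissible I \<sigma> \<kappa>" for \<kappa>
    proof -
      have exit: "until_prob F G \<kappa> (xs @ [t]) \<le> - ?v t" "t \<in> W \<Longrightarrow> until_prob F G \<kappa> (xs @ [t]) < - ?v t"
        if "set xs \<subseteq> V" "t \<notin> V" for xs t
      proof -
        have "trans_mix I (last \<omega>) (\<tau> t \<omega>) (\<kappa> (xs @ \<omega>))" if \<omega>: "\<omega> \<noteq> []" "hd \<omega> = t" for \<omega>
        proof -
          have "dropWhile (\<lambda>s. s \<in> V) (xs @ \<omega>) = \<omega>"
            using \<open>set xs \<subseteq> V\<close> \<open>t \<notin> V\<close> \<omega> by (cases \<omega>) (auto simp: dropWhile_append)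
          then show ?thesis
            using \<kappa>[unfolded admissible_def, rule_format, of "xs @ \<omega>"] \<omega> by (simp add: \<sigma>_def)
        qed
        from admissible_cut[of t "\<tau> t" \<kappa> xs, OF this] obtain \<kappa>' where
          "admissible I (\<tau> t) \<kappa>'" "until_prob F G \<kappa>' [t] = until_prob F G \<kappa> (xs @ [t])" by blast
        then show "until_prob F G \<kappa> (xs @ [t]) \<le> - ?v t" "t \<in> W \<Longrightarrow> until_prob F G \<kappa> (xs @ [t]) < - ?v t"
          using \<tau> by metis+
      qed
      have inV: "?v (last \<omega>) < expv (\<kappa> \<omega>) ?v \<or>
        ?v (last \<omega>) = expv (\<kappa> \<omega>) ?v \<and> (set_pmf (\<kappa> \<omega>) \<inter> W \<noteq> {} \<or> set_pmf (\<kappa> \<omega>) \<subseteq> Y)"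
        if \<omega>: "\<omega> \<noteq> []" "set \<omega> \<subseteq> V" for \<omega>
      proof -
        have "dropWhile (\<lambda>s. s \<in> V) \<omega> = []" using \<omega>(2) by (auto simp: dropWhile_eq_Nil_conv)
        then have "trans_mix I (last \<omega>) (\<rho> (last \<omega>)) (\<kappa> \<omega>)"
          using \<kappa>[unfolded admissible_def, rule_format, of \<omega>] \<omega>(1) by (simp add: \<sigma>_def)
        moreover have "last \<omega> \<in> Y" using \<omega> last_in_set[of \<omega>] unfolding V_def by blast
        ultimately show ?thesis using \<rho> by blast
      qed
      have lastV: "last \<omega> \<in> Y" if "\<omega> \<noteq> []" "set \<omega> \<subseteq> V" for \<omega>
        using that last_in_set[of \<omega>] unfolding V_def by blast
      have le: "until_prob F G \<kappa> \<omega> \<le> - ?v (last \<omega>)" if "\<omega> \<noteq> []" "set (butlast \<omega>) \<subseteq> V" for \<omega>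
      \<comment> \<open>The invariant uses \<open>butlast\<close> because the play is followed up to
        and including its first state outside \<open>V\<close>, where \<open>exit\<close> supplies
        the bound.\<close>
      proof (rule until_prob_le_supermartingale[where Inv="\<lambda>\<omega>. \<omega> \<noteq> [] \<and> set (butlast \<omega>) \<subseteq> V" and \<Phi>="\<lambda>\<omega>. - ?v (last \<omega>)"])
        fix \<omega> assume \<omega>: "\<omega> \<noteq> [] \<and> set (butlast \<omega>) \<subseteq> V"
        show "0 \<le> - ?v (last \<omega>)" using opt_value_nonneg[of 1 "-1" F G] by simp
        show "until_prob F G \<kappa> \<omega> \<le> - ?v (last \<omega>) \<or> last \<omega> \<notin> G \<and>
          expv (\<kappa> \<omega>) (\<lambda>s. - ?v (last (\<omega> @ [s]))) \<le> - ?v (last \<omega>) \<and>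
          (\<forall>s\<in>set_pmf (\<kappa> \<omega>). \<omega> @ [s] \<noteq> [] \<and> set (butlast (\<omega> @ [s])) \<subseteq> V)"
        proof (cases "last \<omega> \<in> V")
          case True
          have "set \<omega> \<subseteq> V" using \<omega> True append_butlast_last_id[of \<omega>] by (metis Un_subset_iff empty_set insert_subset list.simps(15) set_append empty_subsetI)
          then show ?thesis using inV[of \<omega>] lastV[of \<omega>] Y(1) \<omega> by (auto simp: expv_minus)
        next
          case False
          then show ?thesis using exit(1)[of "butlast \<omega>" "last \<omega>"] \<omega> by auto
        qed
      qed (use that in simp)
      \<comment> \<open>Equality would spread to all successors. It excludes those in
        \<open>W\<close>, so the step keeps the play in \<open>Y\<close>, hence in \<open>V\<close>.
        Then the goal is never reached and the probability is 0, against a nonzero value.\<close>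
      have "until_prob F G \<kappa> [s] \<noteq> - ?v s"
      proof
        assume eq: "until_prob F G \<kappa> [s] = - ?v s"
        have "buntil_prob F G \<kappa> k \<omega> = 0" if "\<omega> \<noteq> []" "set \<omega> \<subseteq> V" "until_prob F G \<kappa> \<omega> = - ?v (last \<omega>)" for k \<omega>
          using that
        proof (induction k arbitrary: \<omega>)
          case (Suc k)
          let ?\<mu> = "\<kappa> \<omega>"
          have nt: "last \<omega> \<notin> G" "last \<omega> \<in> F" using lastV[OF Suc.prems(1,2)] Y by auto
          have R: "until_prob F G \<kappa> \<omega> = expv ?\<mu> (\<lambda>t. until_prob F G \<kappa> (\<omega> @ [t]))" using nt by (subst until_prob_rec) simp
          have le': "until_prob F G \<kappa> (\<omega> @ [t]) \<le> - ?v t" for t using le[of "\<omega> @ [t]"] Suc.prems(2) by simp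
          have v: "?v (last \<omega>) \<le> expv ?\<mu> ?v" using inV[OF Suc.prems(1,2)] by auto
          have tight: "until_prob F G \<kappa> (\<omega> @ [t]) = - ?v t" if t: "t \<in> set_pmf ?\<mu>" for t
          proof (rule ccontr)
            assume "until_prob F G \<kappa> (\<omega> @ [t]) \<noteq> - ?v t"
            then have "until_prob F G \<kappa> (\<omega> @ [t]) < - ?v t" using le'[of t] by simp
            then have "until_prob F G \<kappa> \<omega> < expv ?\<mu> (\<lambda>t. - ?v t)" unfolding R
              by (intro expv_strict_mono[OF le' t])
            then show False using v Suc.prems(3) by (simp add: expv_minus)
          qed
          have "until_prob F G \<kappa> \<omega> = - expv ?\<mu> ?v"
            unfolding R by (subst expv_minus[symmetric], rule expv_cong, rule tight)
          then have "?v (last \<omega>) = expv ?\<mu> ?v" using Suc.prems(3) by simp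
          then have or: "set_pmf ?\<mu> \<inter> W \<noteq> {} \<or> set_pmf ?\<mu> \<subseteq> Y" using inV[OF Suc.prems(1,2)] by auto
          have W: "t \<notin> W" if "t \<in> set_pmf ?\<mu>" for t
            using tight[OF that] exit(2)[OF Suc.prems(2), of t] by (auto simp: V_def)
          then have "set_pmf ?\<mu> \<subseteq> V" using or by (auto simp: V_def)
          then have "buntil_prob F G \<kappa> k (\<omega> @ [t]) = 0" if "t \<in> set_pmf ?\<mu>" for t
            using Suc.prems(2) tight[OF that] that by (intro Suc.IH) auto
          then have "expv ?\<mu> (\<lambda>t. buntil_prob F G \<kappa> k (\<omega> @ [t])) = expv ?\<mu> (\<lambda>_. 0)" by (rule expv_cong)
          then show ?case using nt by simp
        qed simp
        from this[of "[s]"] have "until_prob F G \<kappa> [s] \<le> 0" using s eq by (intro until_prob_least) simp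
        moreover have "?v s < 0" using Y(3) s by (simp add: V_def)
        ultimately show False using eq by simp
      qed
      moreover have "until_prob F G \<kappa> [s] \<le> - ?v s" using le[of "[s]"] by simp
      ultimately show ?thesis by simp
    qed
    then show ?thesis unfolding strict_win_def by blast
  qed
  have "Y \<subseteq> strict_win I F G (-1)"
    using strict_win_V by (auto simp: V_def W_def)
  then show "gfp (win_step_min I F G (lfp (\<lambda>X. gfp (win_step_min I F G X)) \<inter> strict_win I F G (-1))) \<subseteq> strict_win I F G (-1)"
    by (simp add: Y_def W_def)
qed

text \<open>Nature plays \<open>A\<close> as long as this is exactly optimal. After a step at which the scheduler loses an
amount \<open>b\<close> of expected value, nature can afford to play \<open>b\<close>-optimally for ever.\<close>

lemma nature_switch:
  fixes c :: real and v and F G :: "'s set"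
  defines "v \<equiv> opt_value I F G c 1"
  assumes c: "c = 1 \<or> c = -1"
    and A: "\<And>\<omega>. \<omega> \<noteq> [] \<Longrightarrow> trans_mix I (last \<omega>) (\<sigma> \<omega>) (A \<omega>)"
  obtains \<kappa> b where "admissible I \<sigma> \<kappa>" "\<And>s. b [s] = 0"
    "\<And>\<omega>. \<omega> \<noteq> [] \<Longrightarrow> 0 < b \<omega> \<Longrightarrow> c * until_prob F G \<kappa> \<omega> \<le> v (last \<omega>) + b \<omega>"
    "\<And>\<omega>. b \<omega> = 0 \<Longrightarrow> \<kappa> \<omega> = A \<omega>"
    "\<And>\<omega> s. \<omega> \<noteq> [] \<Longrightarrow> b \<omega> = 0 \<Longrightarrow> b (\<omega> @ [s]) = v (last \<omega>) - expv (A \<omega>) v"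
proof -
  \<comment> \<open>The budget is frozen at its first positive value, so all extensions of a history
    after the switch use the same kernel \<open>K (b \<omega>)\<close>.\<close>
  obtain b where b: "\<And>s. b [s] = 0"
    "\<And>\<omega> s. \<omega> \<noteq> [] \<Longrightarrow> b (\<omega> @ [s]) = (if 0 < b \<omega> then b \<omega> else v (last \<omega>) - expv (A \<omega>) v)"
    using snoc_recursion[of 0 "\<lambda>\<omega> r. if 0 < r then r else v (last \<omega>) - expv (A \<omega>) v"] by blast
  have "\<forall>e. \<exists>\<kappa>. 0 < e \<longrightarrow> admissible I \<sigma> \<kappa> \<and> (\<forall>\<omega>. \<omega> \<noteq> [] \<longrightarrow> c * until_prob F G \<kappa> \<omega> \<le> v (last \<omega>) + e)"
    using nature_approx[OF _ c, of _ \<sigma> F G] unfolding v_def by blast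
  then obtain K where K: "\<And>e. 0 < e \<Longrightarrow> admissible I \<sigma> (K e)"
    "\<And>e \<omega>. 0 < e \<Longrightarrow> \<omega> \<noteq> [] \<Longrightarrow> c * until_prob F G (K e) \<omega> \<le> v (last \<omega>) + e" by metis
  define \<kappa> where "\<kappa> \<omega> = (if 0 < b \<omega> then K (b \<omega>) \<omega> else A \<omega>)" for \<omega>
  have "admissible I \<sigma> \<kappa>" using A K(1) by (auto simp: admissible_def \<kappa>_def)
  moreover have "c * until_prob F G \<kappa> \<omega> \<le> v (last \<omega>) + b \<omega>" if \<omega>: "\<omega> \<noteq> []" "0 < b \<omega>" for \<omega>
  proof -
    have "b (\<omega> @ xs) = b \<omega>" for xs
    proof (induction xs rule: rev_induct)
      case (snoc x xs)
      then show ?case using b(2)[of "\<omega> @ xs" x] \<omega> by simp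
    qed simp
    then have "until_prob F G \<kappa> \<omega> = until_prob F G (K (b \<omega>)) \<omega>"
      using \<omega>(2) by (intro until_prob_cong_ext) (simp add: \<kappa>_def)
    then show ?thesis using K(2)[OF \<omega>(2,1)] by simp
  qed
  ultimately show thesis using b by (intro that[of \<kappa> b]) (auto simp: \<kappa>_def)
qed

text \<open>Outside the least fixed point, every choice of the scheduler has an answer that lowers
  the expected value, or preserves it without leaving this complement. Either way nature never
  exceeds the value.\<close>

lemma nature_attains_max:
  assumes s: "s \<notin> lfp (win_step_max I F G)"
  shows "\<exists>\<kappa>. admissible I \<sigma> \<kappa> \<and> until_prob F G \<kappa> [s] \<le> opt_value I F G 1 1 s"
proof -
  let ?v = "opt_value I F G 1 1"
  define N where "N = - lfp (win_step_max I F G)"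
  have N: "N = - win_step_max I F G (- N)" unfolding N_def using lfp_unfold[OF mono_win_step_max, of I F G] by simp
  have "\<forall>\<omega>. \<exists>\<mu>. trans_mix I (last \<omega>) (\<sigma> \<omega>) \<mu> \<and> (last \<omega> \<in> N \<longrightarrow> last \<omega> \<notin> G \<longrightarrow> last \<omega> \<in> F \<longrightarrow>
     expv \<mu> ?v < ?v (last \<omega>) \<or> expv \<mu> ?v = ?v (last \<omega>) \<and> set_pmf \<mu> \<subseteq> N)"
  proof
    fix \<omega> :: "'s list"
    show "\<exists>\<mu>. trans_mix I (last \<omega>) (\<sigma> \<omega>) \<mu> \<and> (last \<omega> \<in> N \<longrightarrow> last \<omega> \<notin> G \<longrightarrow> last \<omega> \<in> F \<longrightarrow>
     expv \<mu> ?v < ?v (last \<omega>) \<or> expv \<mu> ?v = ?v (last \<omega>) \<and> set_pmf \<mu> \<subseteq> N)"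
    proof (cases "last \<omega> \<in> N \<and> last \<omega> \<notin> G \<and> last \<omega> \<in> F")
      case True
      then have "last \<omega> \<notin> win_step_max I F G (- N)" using N by blast
      then obtain \<mu> where \<mu>: "trans_mix I (last \<omega>) (\<sigma> \<omega>) \<mu>"
        "\<not> (?v (last \<omega>) < expv \<mu> ?v \<or> ?v (last \<omega>) = expv \<mu> ?v \<and> set_pmf \<mu> \<inter> - N \<noteq> {})"
        using True unfolding win_step_max_def by blast
      then have "expv \<mu> ?v < ?v (last \<omega>) \<or> expv \<mu> ?v = ?v (last \<omega>) \<and> set_pmf \<mu> \<subseteq> N" by force
      then show ?thesis using \<mu>(1) by blast
    qed (use trans_mix_exists in blast)
  qed
  then obtain A where A: "\<And>\<omega>. trans_mix I (last \<omega>) (\<sigma> \<omega>) (A \<omega>)"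
    "\<And>\<omega>. last \<omega> \<in> N \<Longrightarrow> last \<omega> \<notin> G \<Longrightarrow> last \<omega> \<in> F \<Longrightarrow>
      expv (A \<omega>) ?v < ?v (last \<omega>) \<or> expv (A \<omega>) ?v = ?v (last \<omega>) \<and> set_pmf (A \<omega>) \<subseteq> N" by metis
  obtain \<kappa> b where \<kappa>: "admissible I \<sigma> \<kappa>" and b: "\<And>s. b [s] = 0"
    "\<And>\<omega>. \<omega> \<noteq> [] \<Longrightarrow> 0 < b \<omega> \<Longrightarrow> 1 * until_prob F G \<kappa> \<omega> \<le> ?v (last \<omega>) + b \<omega>"
    "\<And>\<omega>. b \<omega> = 0 \<Longrightarrow> \<kappa> \<omega> = A \<omega>"
    "\<And>\<omega> s. \<omega> \<noteq> [] \<Longrightarrow> b \<omega> = 0 \<Longrightarrow> b (\<omega> @ [s]) = ?v (last \<omega>) - expv (A \<omega>) ?v"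
    by (rule nature_switch[of 1 \<sigma> A F G]) (use A in auto)
  have "until_prob F G \<kappa> [s] \<le> ?v (last [s]) + b [s]"
  \<comment> \<open>The budget opened at a strict loss equals the loss, so the potential
    \<open>?v + b\<close> has no drift at the switch.\<close>
  proof (rule until_prob_le_supermartingale[where Inv="\<lambda>\<omega>. \<omega> \<noteq> [] \<and> (0 < b \<omega> \<or> b \<omega> = 0 \<and> last \<omega> \<in> N)" and \<Phi>="\<lambda>\<omega>. ?v (last \<omega>) + b \<omega>"])
    show "[s] \<noteq> [] \<and> (0 < b [s] \<or> b [s] = 0 \<and> last [s] \<in> N)" using s b(1) by (simp add: N_def)
    fix \<omega> assume \<omega>: "\<omega> \<noteq> [] \<and> (0 < b \<omega> \<or> b \<omega> = 0 \<and> last \<omega> \<in> N)"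
    show "0 \<le> ?v (last \<omega>) + b \<omega>" using opt_value_nonneg[of 1 1 F G "last \<omega>"] \<omega> by auto
    consider "0 < b \<omega>" | "last \<omega> \<in> G \<or> last \<omega> \<notin> F" "b \<omega> = 0" | "b \<omega> = 0" "last \<omega> \<in> N" "last \<omega> \<notin> G" "last \<omega> \<in> F"
      using \<omega> by blast
    then show "until_prob F G \<kappa> \<omega> \<le> ?v (last \<omega>) + b \<omega> \<or> last \<omega> \<notin> G \<and>
      expv (\<kappa> \<omega>) (\<lambda>s. ?v (last (\<omega> @ [s])) + b (\<omega> @ [s])) \<le> ?v (last \<omega>) + b \<omega> \<and>
      (\<forall>s\<in>set_pmf (\<kappa> \<omega>). \<omega> @ [s] \<noteq> [] \<and> (0 < b (\<omega> @ [s]) \<or> b (\<omega> @ [s]) = 0 \<and> last (\<omega> @ [s]) \<in> N))"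
    proof cases
      case 1
      then show ?thesis using b(2) \<omega> by simp
    next
      case 2
      then show ?thesis using opt_value_rec[of 1 1 F G "last \<omega>"] by (subst until_prob_rec) auto
    next
      case 3
      show ?thesis using A(2)[OF 3(2-4)] 3 b(3)[OF 3(1)] b(4)[of \<omega>] \<omega> by (auto simp: expv_add)
    qed
  qed
  then show ?thesis using \<kappa> b(1) by auto
qed

text \<open>Preserving the value is not enough for nature here, since it has to reach the goal.
  Outside the outer fixed point, \<open>gfp_rank\<close> supplies value-preserving answers that also
  lower the rank with positive probability.\<close>

lemma nature_attains_min:
  assumes s: "s \<notin> lfp (\<lambda>X. gfp (win_step_min I F G X))"
  shows "\<exists>\<kappa>. admissible I \<sigma> \<kappa> \<and> - until_prob F G \<kappa> [s] \<le> opt_value I F G (-1) 1 s"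
proof -
  let ?v = "opt_value I F G (-1) 1"
  define X where "X = lfp (\<lambda>X. gfp (win_step_min I F G X))"
  have X: "X = gfp (win_step_min I F G X)" unfolding X_def by (rule lfp_unfold[OF mono_gfp_win_step_min])
  obtain r :: "'s \<Rightarrow> nat" where r: "\<And>s. s \<notin> X \<Longrightarrow> s \<notin> win_step_min I F G X {t. t \<in> X \<or> r s \<le> r t}"
    using gfp_rank[OF mono_win_step_min, of I F G X] X by auto
  define N where "N = - X"
  let ?L = "\<lambda>s. {t. r t < r s}"
  \<comment> \<open>Answers are fixed per state and pure action instead of per history. There are
    then finitely many, and their chances of lowering the rank have a positive minimum
    \<open>\<delta>\<close>, whatever the scheduler mixes.\<close>
  have "\<forall>s a. \<exists>\<mu>. \<mu> \<in> Gamma I s a \<and> (s \<in> N \<longrightarrow> s \<notin> G \<longrightarrow> s \<in> F \<longrightarrow> ?v s < 0 \<longrightarrow>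
    expv \<mu> ?v < ?v s \<or> expv \<mu> ?v = ?v s \<and> set_pmf \<mu> \<subseteq> N \<and> set_pmf \<mu> \<inter> ?L s \<noteq> {})"
  proof (intro allI)
    fix s :: 's and a :: 'a
    show "\<exists>\<mu>. \<mu> \<in> Gamma I s a \<and> (s \<in> N \<longrightarrow> s \<notin> G \<longrightarrow> s \<in> F \<longrightarrow> ?v s < 0 \<longrightarrow>
      expv \<mu> ?v < ?v s \<or> expv \<mu> ?v = ?v s \<and> set_pmf \<mu> \<subseteq> N \<and> set_pmf \<mu> \<inter> ?L s \<noteq> {})"
    proof (cases "s \<in> N \<and> s \<notin> G \<and> s \<in> F \<and> ?v s < 0")
      case True
      then have "s \<notin> win_step_min I F G X {t. t \<in> X \<or> r s \<le> r t}" using r by (simp add: N_def)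
      then obtain \<mu> where \<mu>: "trans_mix I s (return_pmf a) \<mu>"
        "\<not> (?v s < expv \<mu> ?v \<or> ?v s = expv \<mu> ?v \<and> (set_pmf \<mu> \<inter> X \<noteq> {} \<or> set_pmf \<mu> \<subseteq> {t. t \<in> X \<or> r s \<le> r t}))"
        using True unfolding win_step_min_def by blast
      have "expv \<mu> ?v < ?v s \<or> expv \<mu> ?v = ?v s \<and> set_pmf \<mu> \<subseteq> N \<and> set_pmf \<mu> \<inter> ?L s \<noteq> {}"
        using \<mu>(2) by (force simp: N_def not_le)
      then show ?thesis using \<mu>(1) by (auto simp: trans_mix_return)
    qed (use Gamma_nonempty in blast)
  qed
  then obtain m where m: "\<And>s a. m s a \<in> Gamma I s a"
    "\<And>s a. s \<in> N \<Longrightarrow> s \<notin> G \<Longrightarrow> s \<in> F \<Longrightarrow> ?v s < 0 \<Longrightarrow>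
      expv (m s a) ?v < ?v s \<or> expv (m s a) ?v = ?v s \<and> set_pmf (m s a) \<subseteq> N \<and> set_pmf (m s a) \<inter> ?L s \<noteq> {}" by metis
  \<comment> \<open>The default 1 keeps answers that cannot lower the rank from turning the minimum
    into 0.\<close>
  define p where "p = (\<lambda>(s, a). if set_pmf (m s a) \<inter> ?L s \<noteq> {} then expv (m s a) (indicator (?L s)) else 1)"
  define \<delta> where "\<delta> = Min (range p)"
  have p_pos: "0 < p sa" for sa
  proof -
    obtain s a where sa: "sa = (s, a)" by (cases sa)
    have "0 < expv (m s a) (indicator (?L s))" if "t \<in> set_pmf (m s a)" "t \<in> ?L s" for t
      using expv_strict_mono[of "m s a" "\<lambda>_. 0" "indicator (?L s)" t] that by simp
    then show ?thesis by (auto simp: p_def sa)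
  qed
  have \<delta>: "0 < \<delta>" unfolding \<delta>_def using p_pos by (subst Min_gr_iff) auto
  have \<delta>_le: "\<delta> \<le> p sa" for sa unfolding \<delta>_def by (rule Min_le) auto
  have p_le: "p sa \<le> 1" for sa
    using expv_mono[of _ "indicator _" "\<lambda>_. 1::real"] by (auto simp: p_def split: prod.splits simp: expv_indicator)
  have \<delta>1: "\<delta> \<le> 1" using order_trans[OF \<delta>_le p_le] .
  define A where "A \<omega> = bind_pmf (\<sigma> \<omega>) (m (last \<omega>))" for \<omega>
  have A: "trans_mix I (last \<omega>) (\<sigma> \<omega>) (A \<omega>)" for \<omega> unfolding trans_mix_iff A_def using m(1) by blast
  obtain \<kappa> b where \<kappa>: "admissible I \<sigma> \<kappa>" and b: "\<And>s. b [s] = 0"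
    "\<And>\<omega>. \<omega> \<noteq> [] \<Longrightarrow> 0 < b \<omega> \<Longrightarrow> -1 * until_prob F G \<kappa> \<omega> \<le> ?v (last \<omega>) + b \<omega>"
    "\<And>\<omega>. b \<omega> = 0 \<Longrightarrow> \<kappa> \<omega> = A \<omega>"
    "\<And>\<omega> s. \<omega> \<noteq> [] \<Longrightarrow> b \<omega> = 0 \<Longrightarrow> b (\<omega> @ [s]) = ?v (last \<omega>) - expv (A \<omega>) ?v"
    by (rule nature_switch[of "-1" \<sigma> A F G]) (use A in auto)
  have "- ?v (last [s]) - b [s] \<le> until_prob F G \<kappa> [s]"
  proof (rule until_prob_ge_progress[where Inv="\<lambda>\<omega>. \<omega> \<noteq> [] \<and> (0 < b \<omega> \<or> b \<omega> = 0 \<and> last \<omega> \<in> N)"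
        and \<Phi>="\<lambda>\<omega>. - ?v (last \<omega>) - b \<omega>" and rk=r, OF _ \<delta> \<delta>1])
    show "[s] \<noteq> [] \<and> (0 < b [s] \<or> b [s] = 0 \<and> last [s] \<in> N)" using s b(1) by (simp add: N_def X_def)
    fix \<omega> assume \<omega>: "\<omega> \<noteq> [] \<and> (0 < b \<omega> \<or> b \<omega> = 0 \<and> last \<omega> \<in> N)"
    show "- ?v (last \<omega>) - b \<omega> \<le> 1" using opt_value_le_1[of 1 "-1" F G "last \<omega>"] \<omega> by auto
    let ?s = "last \<omega>"
    \<comment> \<open>States of value 0 are split off because \<open>m\<close> promises progress
      only for negative value; there the bound is just nonnegativity of the probability.\<close>
    consider "0 < b \<omega>" | "?s \<in> G \<or> ?s \<notin> F" "b \<omega> = 0" | "?v ?s = 0" "b \<omega> = 0"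
      | "b \<omega> = 0" "?s \<in> N" "?s \<notin> G" "?s \<in> F" "?v ?s < 0"
      using \<omega> opt_value_nonneg[of 1 "-1" F G "last \<omega>"] by fastforce
    then show "- ?v (last \<omega>) - b \<omega> \<le> until_prob F G \<kappa> \<omega> \<or>
      last \<omega> \<notin> G \<and> last \<omega> \<in> F \<and> - ?v (last \<omega>) - b \<omega> \<le> expv (\<kappa> \<omega>) (\<lambda>s. - ?v (last (\<omega> @ [s])) - b (\<omega> @ [s])) \<and>
      (\<forall>s\<in>set_pmf (\<kappa> \<omega>). \<omega> @ [s] \<noteq> [] \<and> (0 < b (\<omega> @ [s]) \<or> b (\<omega> @ [s]) = 0 \<and> last (\<omega> @ [s]) \<in> N)) \<and>
      \<delta> \<le> expv (\<kappa> \<omega>) (indicator {s. r s < r (last \<omega>)})"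
    proof cases
      case 1
      then show ?thesis using b(2)[of \<omega>] \<omega> by simp
    next
      case 2
      then show ?thesis using opt_value_rec[of 1 "-1" F G "last \<omega>"] by (subst until_prob_rec) auto
    next
      case 3
      then show ?thesis using until_prob_nonneg[of F G \<kappa> \<omega>] by simp
    next
      case 4
      note m4 = m(2)[OF 4(2-5)]
      have \<kappa>\<omega>: "\<kappa> \<omega> = A \<omega>" by (rule b(3)[OF 4(1)])
      have b': "b (\<omega> @ [t]) = ?v ?s - expv (A \<omega>) ?v" for t using b(4)[of \<omega>] 4(1) \<omega> by blast
      have EA: "expv (A \<omega>) x = expv (\<sigma> \<omega>) (\<lambda>a. expv (m ?s a) x)" for x by (simp add: A_def expv_bind)
      show ?thesis
      \<comment> \<open>One action of the support with a strict loss makes the whole mixture lose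
        and opens the budget. Otherwise all answers preserve the value and make progress, and so
        does their mixture.\<close>
      proof (cases "\<exists>a\<in>set_pmf (\<sigma> \<omega>). expv (m ?s a) ?v < ?v ?s")
        case True
        then obtain a where a: "a \<in> set_pmf (\<sigma> \<omega>)" "expv (m ?s a) ?v < ?v ?s" by blast
        have "expv (A \<omega>) ?v < expv (\<sigma> \<omega>) (\<lambda>_. ?v ?s)" unfolding EA
          by (rule expv_strict_mono[of _ _ _ a]) (use m4 a in \<open>auto simp: le_less\<close>)
        then have "0 < b (\<omega> @ [t])" for t by (simp add: b')
        then have "- ?v t - b (\<omega> @ [t]) \<le> until_prob F G \<kappa> (\<omega> @ [t])" for t using b(2)[of "\<omega> @ [t]"] by simp
        then have "expv (\<kappa> \<omega>) (\<lambda>t. - ?v t - b (\<omega> @ [t])) \<le> expv (\<kappa> \<omega>) (\<lambda>t. until_prob F G \<kappa> (\<omega> @ [t]))"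
          by (intro expv_mono)
        then have "- ?v ?s \<le> until_prob F G \<kappa> \<omega>"
          using 4 by (subst until_prob_rec) (simp add: b' expv_diff expv_minus \<kappa>\<omega>)
        then show ?thesis using 4(1) by simp
      next
        case False
        then have all: "expv (m ?s a) ?v = ?v ?s" "set_pmf (m ?s a) \<subseteq> N" "set_pmf (m ?s a) \<inter> ?L ?s \<noteq> {}"
          if "a \<in> set_pmf (\<sigma> \<omega>)" for a using m4[of a] that by auto
        have eq: "expv (A \<omega>) ?v = ?v ?s"
          unfolding EA using expv_cong[of "\<sigma> \<omega>" "\<lambda>a. expv (m ?s a) ?v" "\<lambda>_. ?v ?s"] all(1) by simp
        have "expv (\<sigma> \<omega>) (\<lambda>_. \<delta>) \<le> expv (A \<omega>) (indicator (?L ?s))" unfolding EA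
        proof (rule expv_mono)
          fix a assume "a \<in> set_pmf (\<sigma> \<omega>)"
          then show "\<delta> \<le> expv (m ?s a) (indicator (?L ?s))" using all(3)[of a] \<delta>_le[of "(?s, a)"] by (simp add: p_def)
        qed
        moreover have "set_pmf (A \<omega>) \<subseteq> N" using all(2) by (auto simp: A_def)
        ultimately show ?thesis using 4 eq by (auto simp: \<kappa>\<omega> b' expv_minus)
      qed
    qed
  qed
  then show ?thesis using \<kappa> b(1) by (intro exI[of _ \<kappa>]) auto
qed

lemma strict_win_max_eq: "strict_win I F G 1 = lfp (win_step_max I F G)"
proof
  show "strict_win I F G 1 \<subseteq> lfp (win_step_max I F G)"
  proof
    fix s assume "s \<in> strict_win I F G 1"
    then obtain \<sigma> where \<sigma>: "\<And>\<kappa>. admissible I \<sigma> \<kappa> \<Longrightarrow> opt_value I F G 1 1 s < until_prob F G \<kappa> [s]" by (auto simp: strict_win_def)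
    show "s \<in> lfp (win_step_max I F G)"
      using nature_attains_max[of s F G \<sigma>] \<sigma> by (meson not_le)
  qed
qed (rule scheduler_strict_win_max)

lemma strict_win_min_eq: "strict_win I F G (-1) = lfp (\<lambda>X. gfp (win_step_min I F G X))"
proof
  show "strict_win I F G (-1) \<subseteq> lfp (\<lambda>X. gfp (win_step_min I F G X))"
  proof
    fix s assume "s \<in> strict_win I F G (-1)"
    then obtain \<sigma> where \<sigma>: "\<And>\<kappa>. admissible I \<sigma> \<kappa> \<Longrightarrow> opt_value I F G (-1) 1 s < - until_prob F G \<kappa> [s]" by (auto simp: strict_win_def)
    show "s \<in> lfp (\<lambda>X. gfp (win_step_min I F G X))"
      using nature_attains_min[of s F G \<sigma>] \<sigma> by (meson not_le)
  qed
qed (rule scheduler_strict_win_min)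

text \<open>The scheduler attains the value exactly; nature only approaches it, which suffices to
  refute a larger non-strict bound.\<close>

lemma forces_ge_iff:
  assumes c: "c = 1 \<or> c = -1"
  shows "(\<exists>\<sigma>. \<forall>\<kappa>. admissible I \<sigma> \<kappa> \<longrightarrow> y \<le> c * until_prob F G \<kappa> [s]) \<longleftrightarrow> y \<le> opt_value I F G c 1 s"
proof
  assume "\<exists>\<sigma>. \<forall>\<kappa>. admissible I \<sigma> \<kappa> \<longrightarrow> y \<le> c * until_prob F G \<kappa> [s]"
  then obtain \<sigma> where \<sigma>: "\<And>\<kappa>. admissible I \<sigma> \<kappa> \<Longrightarrow> y \<le> c * until_prob F G \<kappa> [s]" by blast
  show "y \<le> opt_value I F G c 1 s"
  proof (rule field_le_epsilon)
    fix e :: real assume "0 < e"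
    from nature_approx[OF this c, of \<sigma> F G] obtain \<kappa> where
      "admissible I \<sigma> \<kappa>" "c * until_prob F G \<kappa> [s] \<le> opt_value I F G c 1 (last [s]) + e" by blast
    then show "y \<le> opt_value I F G c 1 s + e" using \<sigma>[of \<kappa>] by simp
  qed
next
  assume "y \<le> opt_value I F G c 1 s"
  moreover obtain \<sigma> where "\<And>\<kappa> \<omega>. admissible I \<sigma> \<kappa> \<Longrightarrow> \<omega> \<noteq> [] \<Longrightarrow> opt_value I F G c 1 (last \<omega>) \<le> c * until_prob F G \<kappa> \<omega>"
    using scheduler_optimal[OF c, of F G] by blast
  ultimately have "y \<le> c * until_prob F G \<kappa> [s]" if "admissible I \<sigma> \<kappa>" for \<kappa>
    using that by (metis last.simps not_Cons_self2 order_trans)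
  then show "\<exists>\<sigma>. \<forall>\<kappa>. admissible I \<sigma> \<kappa> \<longrightarrow> y \<le> c * until_prob F G \<kappa> [s]" by blast
qed

lemma forces_gt_iff:
  assumes c: "c = 1 \<or> c = -1"
  shows "(\<exists>\<sigma>. \<forall>\<kappa>. admissible I \<sigma> \<kappa> \<longrightarrow> y < c * until_prob F G \<kappa> [s]) \<longleftrightarrow>
    y < opt_value I F G c 1 s \<or> y = opt_value I F G c 1 s \<and> s \<in> strict_win I F G c"
proof
  assume *: "\<exists>\<sigma>. \<forall>\<kappa>. admissible I \<sigma> \<kappa> \<longrightarrow> y < c * until_prob F G \<kappa> [s]"
  then have "y \<le> opt_value I F G c 1 s" using forces_ge_iff[OF c, of y F G s] less_imp_le by blast
  moreover have "s \<in> strict_win I F G c" if "y = opt_value I F G c 1 s"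
    using * unfolding that strict_win_def by blast
  ultimately show "y < opt_value I F G c 1 s \<or> y = opt_value I F G c 1 s \<and> s \<in> strict_win I F G c"
    by linarith
next
  assume "y < opt_value I F G c 1 s \<or> y = opt_value I F G c 1 s \<and> s \<in> strict_win I F G c"
  then show "\<exists>\<sigma>. \<forall>\<kappa>. admissible I \<sigma> \<kappa> \<longrightarrow> y < c * until_prob F G \<kappa> [s]"
  proof
    assume "y < opt_value I F G c 1 s"
    then show ?thesis using forces_ge_iff[OF c, of "opt_value I F G c 1 s" F G s] by (meson order_less_le_trans order_refl)
  next
    assume "y = opt_value I F G c 1 s \<and> s \<in> strict_win I F G c"
    then show ?thesis unfolding strict_win_def by blast
  qed
qed

end

section \<open>Invariance under bisimulation\<close>

locale bisim_game = until_game I for I :: "'s::finite \<Rightarrow> 'a::finite \<Rightarrow> 's \<Rightarrow> real set" +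
  fixes L :: "'s \<Rightarrow> 'p set" and R :: "('s \<times> 's) set"
  assumes bisim: "bisim I L R"
begin

definition same :: "'s pmf \<Rightarrow> 's pmf \<Rightarrow> bool" where
  "same \<mu> \<nu> \<longleftrightarrow> (\<forall>C\<in>UNIV // R. measure_pmf.prob \<mu> C = measure_pmf.prob \<nu> C)"

definition class_inv :: "('s \<Rightarrow> 'b) \<Rightarrow> bool" where
  "class_inv x \<longleftrightarrow> (\<forall>s t. (s, t) \<in> R \<longrightarrow> x s = x t)"

abbreviation saturated :: "'s set \<Rightarrow> bool" where
  "saturated X \<equiv> class_inv (\<lambda>s. s \<in> X)"

lemma class_invD: "class_inv x \<Longrightarrow> (s, t) \<in> R \<Longrightarrow> x s = x t"
  by (auto simp: class_inv_def)

lemma equiv_R: "equiv UNIV R" using bisim by (simp add: bisim_def)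

lemma R_sym: "(s, t) \<in> R \<Longrightarrow> (t, s) \<in> R"
  using equiv_R by (meson equiv_def symD)

lemma R_refl: "(s, s) \<in> R"
  using equiv_R by (auto simp: equiv_def refl_on_def)

lemma R_trans: "(s, t) \<in> R \<Longrightarrow> (t, u) \<in> R \<Longrightarrow> (s, u) \<in> R"
  using equiv_R by (meson equiv_def transD)

lemma class_invI: "(\<And>s t y. (s, t) \<in> R \<Longrightarrow> (y::real) \<le> x s \<Longrightarrow> y \<le> x t) \<Longrightarrow> class_inv x"
  unfolding class_inv_def by (meson R_sym order_antisym order_refl)

lemma saturatedI: "(\<And>s t. (s, t) \<in> R \<Longrightarrow> s \<in> X \<Longrightarrow> t \<in> X) \<Longrightarrow> saturated X"
  unfolding class_inv_def by (meson R_sym)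

lemma same_expv:
  assumes "same \<mu> \<nu>" "class_inv x"
  shows "expv \<mu> x = expv \<nu> x"
proof -
  have *: "expv \<mu> x = (\<Sum>C\<in>UNIV // R. measure_pmf.prob \<mu> C * x (SOME s. s \<in> C))" for \<mu>
  proof -
    have "expv \<mu> x = (\<Sum>s\<in>\<Union>(UNIV // R). pmf \<mu> s * x s)"
      unfolding expv_def using Union_quotient[OF equiv_R] by simp
    also have "\<dots> = (\<Sum>C\<in>UNIV // R. \<Sum>s\<in>C. pmf \<mu> s * x s)"
      using quotient_disj[OF equiv_R] by (subst sum.Union_disjoint) auto
    also have "\<dots> = (\<Sum>C\<in>UNIV // R. measure_pmf.prob \<mu> C * x (SOME s. s \<in> C))"
    proof (rule sum.cong[OF refl])
      fix C assume C: "C \<in> UNIV // R"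
      have "x s = x (SOME s. s \<in> C)" if "s \<in> C" for s
      proof -
        have "(SOME s. s \<in> C) \<in> C" using that by (metis someI)
        then have "(s, SOME s. s \<in> C) \<in> R" using that C equiv_R by (metis in_quotient_imp_in_rel insert_subset empty_subsetI)
        then show ?thesis using assms(2) by (rule class_invD[rotated])
      qed
      then show "(\<Sum>s\<in>C. pmf \<mu> s * x s) = measure_pmf.prob \<mu> C * x (SOME s. s \<in> C)"
        by (simp add: measure_measure_pmf_finite sum_distrib_right)
    qed
    finally show ?thesis .
  qed
  show ?thesis using assms(1) unfolding *[of \<mu>] *[of \<nu>] by (intro sum.cong) (auto simp: same_def)
qed

lemma saturated_indicator: "saturated X \<Longrightarrow> class_inv (indicator X :: 's \<Rightarrow> real)"
  by (auto simp: class_inv_def indicator_def)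

text \<open>A set meets the support iff it has positive mass; this is how equality of class masses
  controls supports.\<close>

lemma same_meets:
  assumes "same \<mu> \<nu>" "saturated X"
  shows "set_pmf \<mu> \<inter> X \<noteq> {} \<longleftrightarrow> set_pmf \<nu> \<inter> X \<noteq> {}"
proof -
  have "set_pmf \<mu> \<inter> X = {} \<longleftrightarrow> expv \<mu> (indicator X) = 0" for \<mu>
    by (simp add: expv_indicator measure_pmf_zero_iff)
  then show ?thesis using same_expv[OF assms(1) saturated_indicator[OF assms(2)]] by simp
qed

lemma same_subset:
  assumes "same \<mu> \<nu>" "saturated X"
  shows "set_pmf \<mu> \<subseteq> X \<longleftrightarrow> set_pmf \<nu> \<subseteq> X"
proof -
  have "saturated (- X)" using assms(2) by (auto simp: class_inv_def)
  from same_meets[OF assms(1) this] show ?thesis by (simp add: disjoint_eq_subset_Compl)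
qed

lemma transfer_mix:
  assumes "(s, t) \<in> R"
  shows "\<exists>\<rho>'. \<forall>\<nu>. trans_mix I t \<rho>' \<nu> \<longrightarrow> (\<exists>\<mu>. trans_mix I s \<rho> \<mu> \<and> same \<mu> \<nu>)"
  using bisim assms unfolding bisim_def same_def by fast

text \<open>Each answer at \<open>t\<close> to the matching choice is imitated by an answer at
  \<open>s\<close>, where the guarantee already holds. Value iteration, both kinds of winning step
  and the next operator use bisimulation in this form.\<close>

lemma transfer_choice:
  assumes "(s, t) \<in> R" and "\<And>\<mu> \<nu>. same \<mu> \<nu> \<Longrightarrow> Q \<mu> \<Longrightarrow> Q \<nu>"
    and "\<exists>\<rho>. \<forall>\<mu>. trans_mix I s \<rho> \<mu> \<longrightarrow> Q \<mu>"
  shows "\<exists>\<rho>. \<forall>\<mu>. trans_mix I t \<rho> \<mu> \<longrightarrow> Q \<mu>"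
  using transfer_mix[OF assms(1)] assms(2,3) by metis

lemma class_inv_step_value: "class_inv x \<Longrightarrow> class_inv (\<lambda>s. step_value I s x)"
proof (rule class_invI)
  fix s t and y :: real
  assume x: "class_inv x" and st: "(s, t) \<in> R" and "y \<le> step_value I s x"
  then have "\<exists>\<rho>. \<forall>\<mu>. trans_mix I s \<rho> \<mu> \<longrightarrow> y \<le> expv \<mu> x" by (simp add: le_step_value_iff_mix)
  then have "\<exists>\<rho>. \<forall>\<mu>. trans_mix I t \<rho> \<mu> \<longrightarrow> y \<le> expv \<mu> x"
    by (rule transfer_choice[OF st, rotated]) (simp add: same_expv[OF _ x])
  then show "y \<le> step_value I t x" by (simp add: le_step_value_iff_mix)
qed

lemma class_inv_opt_value:
  assumes F: "saturated F" and G: "saturated G"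
  shows "class_inv (opt_value I F G c l)"
proof -
  have "class_inv (value_iter I F G c l n)" for n
  proof (induction n)
    case (Suc n)
    show ?case unfolding class_inv_def
    proof (intro allI impI)
      fix s t assume st: "(s, t) \<in> R"
      show "value_iter I F G c l (Suc n) s = value_iter I F G c l (Suc n) t"
        using class_invD[OF F st] class_invD[OF G st] class_invD[OF class_inv_step_value[OF Suc] st] by simp
    qed
  qed (simp add: class_inv_def)
  then show ?thesis by (auto simp: class_inv_def opt_value_def)
qed

lemma saturated_win_step_max:
  assumes F: "saturated F" and G: "saturated G" and X: "saturated X"
  shows "saturated (win_step_max I F G X)"
proof (rule saturatedI)
  fix s t assume st: "(s, t) \<in> R" and s: "s \<in> win_step_max I F G X"
  let ?v = "opt_value I F G 1 1"
  have v: "class_inv ?v" by (rule class_inv_opt_value[OF F G])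
  from s have "\<exists>\<rho>. \<forall>\<mu>. trans_mix I s \<rho> \<mu> \<longrightarrow> ?v s < expv \<mu> ?v \<or> ?v s = expv \<mu> ?v \<and> set_pmf \<mu> \<inter> X \<noteq> {}"
    unfolding win_step_max_def by blast
  then have "\<exists>\<rho>. \<forall>\<mu>. trans_mix I t \<rho> \<mu> \<longrightarrow> ?v s < expv \<mu> ?v \<or> ?v s = expv \<mu> ?v \<and> set_pmf \<mu> \<inter> X \<noteq> {}"
    by (rule transfer_choice[OF st, rotated]) (simp add: same_expv[OF _ v] same_meets[OF _ X])
  then show "t \<in> win_step_max I F G X"
    using s class_invD[OF F st] class_invD[OF G st] class_invD[OF v st] by (simp add: win_step_max_def)
qed

lemma saturated_win_step_min:
  assumes F: "saturated F" and G: "saturated G" and X: "saturated X" and Y: "saturated Y"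
  shows "saturated (win_step_min I F G X Y)"
proof (rule saturatedI)
  fix s t assume st: "(s, t) \<in> R" and s: "s \<in> win_step_min I F G X Y"
  let ?v = "opt_value I F G (-1) 1"
  have v: "class_inv ?v" by (rule class_inv_opt_value[OF F G])
  from s have "\<exists>\<rho>. \<forall>\<mu>. trans_mix I s \<rho> \<mu> \<longrightarrow> ?v s < expv \<mu> ?v \<or>
      ?v s = expv \<mu> ?v \<and> (set_pmf \<mu> \<inter> X \<noteq> {} \<or> set_pmf \<mu> \<subseteq> Y)"
    unfolding win_step_min_def by blast
  then have "\<exists>\<rho>. \<forall>\<mu>. trans_mix I t \<rho> \<mu> \<longrightarrow> ?v s < expv \<mu> ?v \<or>
      ?v s = expv \<mu> ?v \<and> (set_pmf \<mu> \<inter> X \<noteq> {} \<or> set_pmf \<mu> \<subseteq> Y)"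
    by (rule transfer_choice[OF st, rotated])
      (simp add: same_expv[OF _ v] same_meets[OF _ X] same_subset[OF _ Y])
  then show "t \<in> win_step_min I F G X Y"
    using s class_invD[OF F st] class_invD[OF G st] class_invD[OF v st] by (simp add: win_step_min_def)
qed

text \<open>Saturated sets are closed under arbitrary unions and intersections and preserved by the
  winning steps, so ordinal induction reaches the nested fixed points without leaving them.\<close>

lemma saturated_strict_win:
  assumes F: "saturated F" and G: "saturated G" and c: "c = 1 \<or> c = -1"
  shows "saturated (strict_win I F G c)"
  using c
proof
  assume "c = 1"
  have "saturated (lfp (win_step_max I F G))"
  proof (rule lfp_ordinal_induct[OF mono_win_step_max])
    fix M :: "'s set set" assume "\<forall>S\<in>M. saturated S" then show "saturated (\<Union>M)"
      unfolding class_inv_def by blast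
  qed (rule saturated_win_step_max[OF F G])
  then show ?thesis using \<open>c = 1\<close> by (simp add: strict_win_max_eq)
next
  assume "c = -1"
  have "saturated (lfp (\<lambda>X. gfp (win_step_min I F G X)))"
  proof (rule lfp_ordinal_induct[OF mono_gfp_win_step_min])
    fix M :: "'s set set" assume "\<forall>S\<in>M. saturated S" then show "saturated (\<Union>M)"
      unfolding class_inv_def by blast
  next
    fix X assume X: "saturated X"
    show "saturated (gfp (win_step_min I F G X))"
    proof (rule gfp_ordinal_induct[OF mono_win_step_min])
      fix M :: "'s set set" assume "\<forall>S\<in>M. saturated S" then show "saturated (\<Inter>M)"
        unfolding class_inv_def by blast
    qed (rule saturated_win_step_min[OF F G X])
  qed
  then show ?thesis using \<open>c = -1\<close> by (simp add: strict_win_min_eq)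
qed

section \<open>Transfer of until formulas\<close>

lemma upsets_linear:
  fixes A B :: "real set"
  assumes "\<And>x y. x \<in> A \<Longrightarrow> x \<le> y \<Longrightarrow> y \<in> A" "\<And>x y. x \<in> B \<Longrightarrow> x \<le> y \<Longrightarrow> y \<in> B"
  shows "A \<subseteq> B \<or> B \<subseteq> A"
  using assms by (meson linear subsetI)

text \<open>The scheduler \<open>\<sigma>'\<close> may depend on \<open>k\<close> and on the pair of
  states, and \<open>\<kappa>\<close> may depend on the whole play \<open>\<kappa>'\<close>; only
  the final probabilities are compared, never single paths.\<close>

lemma bounded_simulation:
  assumes F: "saturated F" and G: "saturated G"
  shows "(s, t) \<in> R \<Longrightarrow> \<exists>\<sigma>'. \<forall>\<kappa>'. admissible I \<sigma>' \<kappa>' \<longrightarrow> (\<exists>\<kappa>. admissible I \<sigma> \<kappa> \<and> c * buntil_prob F G \<kappa> k [s] \<le> c * buntil_prob F G \<kappa>' k [t])"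
proof (induction k arbitrary: s t \<sigma>)
  case 0
  then show ?case using admissible_exists by auto
next
  case (Suc k)
  note FG = class_invD[OF F Suc.prems] class_invD[OF G Suc.prems]
  show ?case
  proof (cases "s \<notin> G \<and> s \<in> F")
    case False
    then have "buntil_prob F G \<kappa> (Suc k) [s] = buntil_prob F G \<kappa>' (Suc k) [t]" for \<kappa> \<kappa>' using FG by auto
    then show ?thesis using admissible_exists by (metis order_refl)
  next
    case True
    define \<sigma>s where "\<sigma>s \<omega> = \<sigma> (s # \<omega>)" for \<omega>
    \<comment> \<open>The bounds below which nature can hold the payoff from \<open>s'\<close>
      against the rest of \<open>\<sigma>\<close>; a smaller set is a better guarantee.\<close>
    define U where "U s' = {x. \<exists>\<kappa>. admissible I \<sigma>s \<kappa> \<and> c * buntil_prob F G \<kappa> k [s'] \<le> x}" for s'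
    have U_up: "x \<in> U s' \<Longrightarrow> x \<le> y \<Longrightarrow> y \<in> U s'" for x y s' unfolding U_def by (auto intro: order_trans)
    have "\<forall>t'. \<exists>\<sigma>'. \<forall>\<kappa>'. admissible I \<sigma>' \<kappa>' \<longrightarrow> (\<forall>s'. (s', t') \<in> R \<longrightarrow> c * buntil_prob F G \<kappa>' k [t'] \<in> U s')"
    proof
      fix t'
      let ?C = "{s'. (s', t') \<in> R}"
      have "t' \<in> ?C" by (simp add: R_refl)
      then have "finite (U ` ?C)" "U ` ?C \<noteq> {}" by auto
      \<comment> \<open>A minimal set is least by linearity. It belongs to the state of the class
        with the best continuation, whose guarantee the induction hypothesis carries to
        \<open>t'\<close>.\<close>
      from finite_has_minimal[OF this] obtain A where A: "A \<in> U ` ?C" "\<forall>B\<in>U ` ?C. B \<subseteq> A \<longrightarrow> A = B" ..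
      obtain s0 where s0: "(s0, t') \<in> R" "A = U s0" using A(1) by blast
      have min: "U s0 \<subseteq> U s'" if "(s', t') \<in> R" for s'
      proof -
        have "U s0 \<subseteq> U s' \<or> U s' \<subseteq> U s0" by (rule upsets_linear) (erule U_up, assumption)+
        moreover have "U s' \<subseteq> U s0 \<longrightarrow> U s0 = U s'" using A(2) that unfolding s0(2) by simp
        ultimately show ?thesis by auto
      qed
      from Suc.IH[OF s0(1), of \<sigma>s] obtain \<sigma>' where
        "\<And>\<kappa>'. admissible I \<sigma>' \<kappa>' \<Longrightarrow> c * buntil_prob F G \<kappa>' k [t'] \<in> U s0" unfolding U_def by blast
      then show "\<exists>\<sigma>'. \<forall>\<kappa>'. admissible I \<sigma>' \<kappa>' \<longrightarrow> (\<forall>s'. (s', t') \<in> R \<longrightarrow> c * buntil_prob F G \<kappa>' k [t'] \<in> U s')"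
        using min by blast
    qed
    then obtain \<tau> where \<tau>: "\<And>t' \<kappa>' s'. admissible I (\<tau> t') \<kappa>' \<Longrightarrow> (s', t') \<in> R \<Longrightarrow> c * buntil_prob F G \<kappa>' k [t'] \<in> U s'"
      by metis
    obtain \<rho> where \<rho>: "\<And>\<nu>. trans_mix I t \<rho> \<nu> \<Longrightarrow> \<exists>\<mu>. trans_mix I s (\<sigma> [s]) \<mu> \<and> same \<mu> \<nu>"
      using transfer_mix[OF Suc.prems] by blast
    define \<sigma>' where "\<sigma>' \<omega> = (if tl \<omega> = [] then \<rho> else \<tau> (hd (tl \<omega>)) (tl \<omega>))" for \<omega>
    have "\<exists>\<kappa>. admissible I \<sigma> \<kappa> \<and> c * buntil_prob F G \<kappa> (Suc k) [s] \<le> c * buntil_prob F G \<kappa>' (Suc k) [t]" if \<kappa>': "admissible I \<sigma>' \<kappa>'" for \<kappa>'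
    proof -
      define \<nu> where "\<nu> = \<kappa>' [t]"
      have "trans_mix I t \<rho> \<nu>" using \<kappa>'[unfolded admissible_def, rule_format, of "[t]"] by (simp add: \<sigma>'_def \<nu>_def)
      then obtain \<mu> where \<mu>: "trans_mix I s (\<sigma> [s]) \<mu>" "same \<mu> \<nu>" using \<rho> by blast
      define y where "y t' = c * buntil_prob F G \<kappa>' k [t, t']" for t'
      have y: "y t' \<in> U s'" if "(s', t') \<in> R" for s' t'
      proof -
        have "trans_mix I (last \<omega>) (\<tau> t' \<omega>) (\<kappa>' ([t] @ \<omega>))" if "\<omega> \<noteq> []" "hd \<omega> = t'" for \<omega>
          using \<kappa>'[unfolded admissible_def, rule_format, of "t # \<omega>"] that by (simp add: \<sigma>'_def)
        from admissible_cut[of t' "\<tau> t'" \<kappa>' "[t]", OF this] obtain \<kappa>'' where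
          "admissible I (\<tau> t') \<kappa>''" "buntil_prob F G \<kappa>'' k [t'] = buntil_prob F G \<kappa>' k [t, t']" by auto
        then show ?thesis using \<tau>[OF _ that] by (metis y_def)
      qed
      \<comment> \<open>The minimum over the class makes \<open>z\<close> class-invariant, so its
        expectation moves from \<open>\<nu>\<close> to \<open>\<mu>\<close>. It is still enforceable
        from each \<open>s'\<close>, since every \<open>y t'\<close> of the class lies in
        \<open>U s'\<close>.\<close>
      define z where "z s' = Min (y ` {t'. (s', t') \<in> R})" for s'
      have z_U: "z s' \<in> U s'" for s'
      proof -
        have "z s' \<in> y ` {t'. (s', t') \<in> R}" unfolding z_def using R_refl[of s'] by (intro Min_in) auto
        then obtain t' where "z s' = y t'" "(s', t') \<in> R" by auto
        then show ?thesis using y[of s' t'] by simp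
      qed
      have "class_inv z" unfolding class_inv_def z_def 
      proof (intro allI impI)
        fix s1 s2 assume "(s1, s2) \<in> R"
        then have "{t'. (s1, t') \<in> R} = {t'. (s2, t') \<in> R}" using R_sym R_trans by blast
        then show "Min (y ` {t'. (s1, t') \<in> R}) = Min (y ` {t'. (s2, t') \<in> R})" by simp
      qed
      have z_le: "z t' \<le> y t'" for t' unfolding z_def by (intro Min_le) (auto simp: R_refl)
      have "\<forall>s'. \<exists>\<kappa>. admissible I \<sigma>s \<kappa> \<and> c * buntil_prob F G \<kappa> k [s'] \<le> z s'" using z_U unfolding U_def by blast
      then obtain K where K: "\<And>s'. admissible I \<sigma>s (K s')" "\<And>s'. c * buntil_prob F G (K s') k [s'] \<le> z s'" by metis
      obtain \<kappa>0 where \<kappa>0: "admissible I \<sigma> \<kappa>0" using admissible_exists by blast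
      \<comment> \<open>\<open>\<kappa>0\<close> only fills histories that do not start at
        \<open>s\<close>, which \<open>admissible\<close> constrains as well.\<close>
      define \<kappa> where "\<kappa> \<omega> = (if hd \<omega> \<noteq> s then \<kappa>0 \<omega> else if tl \<omega> = [] then \<mu> else K (hd (tl \<omega>)) (tl \<omega>))" for \<omega>
      have "admissible I \<sigma> \<kappa>"
        unfolding admissible_def
      proof (intro allI impI)
        fix \<omega> :: "'s list" assume \<omega>: "\<omega> \<noteq> []"
        then obtain x xs where x: "\<omega> = x # xs" by (cases \<omega>) auto
        show "trans_mix I (last \<omega>) (\<sigma> \<omega>) (\<kappa> \<omega>)"
        proof (cases "x = s")
          case True
          then show ?thesis using K(1)[of "hd xs", unfolded admissible_def, rule_format, of xs] \<mu>(1)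
            by (cases "xs = []") (auto simp: x \<kappa>_def \<sigma>s_def)
        next
          case False
          then show ?thesis using \<kappa>0[unfolded admissible_def, rule_format, of \<omega>] by (simp add: x \<kappa>_def)
        qed
      qed
      moreover have "c * buntil_prob F G \<kappa> (Suc k) [s] \<le> c * buntil_prob F G \<kappa>' (Suc k) [t]"
      proof -
        have K_eq: "buntil_prob F G \<kappa> k [s, s'] = buntil_prob F G (K s') k [s']" for s'
        proof -
          have "buntil_prob F G \<kappa> k ([s] @ [s']) = buntil_prob F G (\<lambda>\<omega>. \<kappa> ([s] @ \<omega>)) k [s']" by (rule buntil_prob_append) simp
          also have "\<dots> = buntil_prob F G (K s') k [s']" by (rule buntil_prob_cong_ext) (simp add: \<kappa>_def)
          finally show ?thesis by simp
        qed
        have "c * buntil_prob F G \<kappa> (Suc k) [s] = expv \<mu> (\<lambda>s'. c * buntil_prob F G (K s') k [s'])"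
          using True by (simp add: K_eq expv_cmult) (simp add: \<kappa>_def)
        also have "\<dots> \<le> expv \<mu> z" by (rule expv_mono) (rule K(2))
        also have "\<dots> = expv \<nu> z" by (rule same_expv[OF \<mu>(2) \<open>class_inv z\<close>])
        also have "\<dots> \<le> expv \<nu> y" by (rule expv_mono) (rule z_le)
        also have "\<dots> = c * buntil_prob F G \<kappa>' (Suc k) [t]" using True FG by (simp add: y_def[abs_def] expv_cmult \<nu>_def)
        finally show ?thesis .
      qed
      ultimately show ?thesis by blast
    qed
    then show ?thesis by blast
  qed
qed

text \<open>Domination of plays, unlike equality of values, settles strict and non-strict thresholds
  alike.\<close>

lemma bounded_transfer:
  assumes F: "saturated F" and G: "saturated G" and st: "(s, t) \<in> R"
    and "\<exists>\<sigma>. \<forall>\<kappa>. admissible I \<sigma> \<kappa> \<longrightarrow> cmp_holds cm (buntil_prob F G \<kappa> k [s]) p"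
  shows "\<exists>\<sigma>. \<forall>\<kappa>. admissible I \<sigma> \<kappa> \<longrightarrow> cmp_holds cm (buntil_prob F G \<kappa> k [t]) p"
proof -
  obtain \<sigma> where \<sigma>: "\<And>\<kappa>. admissible I \<sigma> \<kappa> \<Longrightarrow> cmp_holds cm (buntil_prob F G \<kappa> k [s]) p" using assms(4) by blast
  define c :: real where "c = (if cm = CLe \<or> cm = CLt then -1 else 1)"
  have mono: "cmp_holds cm x p \<Longrightarrow> c * x \<le> c * y \<Longrightarrow> cmp_holds cm y p" for x y
    by (cases cm) (auto simp: c_def)
  obtain \<sigma>' where \<sigma>': "\<And>\<kappa>'. admissible I \<sigma>' \<kappa>' \<Longrightarrow> \<exists>\<kappa>. admissible I \<sigma> \<kappa> \<and> c * buntil_prob F G \<kappa> k [s] \<le> c * buntil_prob F G \<kappa>' k [t]"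
    using bounded_simulation[OF F G st] by blast
  have "cmp_holds cm (buntil_prob F G \<kappa>' k [t]) p" if "admissible I \<sigma>' \<kappa>'" for \<kappa>'
    using \<sigma>'[OF that] \<sigma> mono by blast
  then show ?thesis by blast
qed

text \<open>An upper bound \<open>p\<close> on the probability is the lower bound \<open>-p\<close>
  on the payoff with \<open>c = -1\<close>.\<close>

lemma unbounded_transfer:
  assumes F: "saturated F" and G: "saturated G" and st: "(s, t) \<in> R"
    and *: "\<exists>\<sigma>. \<forall>\<kappa>. admissible I \<sigma> \<kappa> \<longrightarrow> cmp_holds cm (until_prob F G \<kappa> [s]) p"
  shows "\<exists>\<sigma>. \<forall>\<kappa>. admissible I \<sigma> \<kappa> \<longrightarrow> cmp_holds cm (until_prob F G \<kappa> [t]) p"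
proof -
  note v = class_invD[OF class_inv_opt_value[OF F G] st] and f = class_invD[OF saturated_strict_win[OF F G] st]
  show ?thesis
  proof (cases cm)
    case CLe
    then show ?thesis using * forces_ge_iff[of "-1" "-p" F G] v by simp
  next
    case CLt
    then show ?thesis using * forces_gt_iff[of "-1" "-p" F G] v f[of "-1"] by simp
  next
    case CGe
    then show ?thesis using * forces_ge_iff[of 1 p F G] v by simp
  next
    case CGt
    then show ?thesis using * forces_gt_iff[of 1 p F G] v f[of 1] by simp
  qed
qed

section \<open>PCTL formulas\<close>

lemma next_forces_iff:
  "(\<exists>\<sigma>. \<forall>\<kappa>. admissible I \<sigma> \<kappa> \<longrightarrow> Q (\<kappa> [s])) \<longleftrightarrow> (\<exists>\<rho>. \<forall>\<mu>. trans_mix I s \<rho> \<mu> \<longrightarrow> Q \<mu>)"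
proof
  assume "\<exists>\<sigma>. \<forall>\<kappa>. admissible I \<sigma> \<kappa> \<longrightarrow> Q (\<kappa> [s])"
  then obtain \<sigma> where \<sigma>: "\<And>\<kappa>. admissible I \<sigma> \<kappa> \<Longrightarrow> Q (\<kappa> [s])" by blast
  obtain \<kappa>0 where \<kappa>0: "admissible I \<sigma> \<kappa>0" using admissible_exists by blast
  have "Q \<mu>" if "trans_mix I s (\<sigma> [s]) \<mu>" for \<mu>
  proof -
    have "admissible I \<sigma> (\<kappa>0([s] := \<mu>))" using \<kappa>0 that by (auto simp: admissible_def)
    from \<sigma>[OF this] show ?thesis by simp
  qed
  then show "\<exists>\<rho>. \<forall>\<mu>. trans_mix I s \<rho> \<mu> \<longrightarrow> Q \<mu>" by blast
next
  assume "\<exists>\<rho>. \<forall>\<mu>. trans_mix I s \<rho> \<mu> \<longrightarrow> Q \<mu>"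
  then obtain \<rho> where \<rho>: "\<And>\<mu>. trans_mix I s \<rho> \<mu> \<Longrightarrow> Q \<mu>" by blast
  have "Q (\<kappa> [s])" if "admissible I (\<lambda>_. \<rho>) \<kappa>" for \<kappa>
    using that[unfolded admissible_def, rule_format, of "[s]"] \<rho> by simp
  then show "\<exists>\<sigma>. \<forall>\<kappa>. admissible I \<sigma> \<kappa> \<longrightarrow> Q (\<kappa> [s])" by blast
qed

lemma sat_SProb_iff:
  "sat I L s (SProb cm p \<psi>) \<longleftrightarrow>
    (\<exists>\<sigma>. \<forall>\<kappa>. admissible I \<sigma> \<kappa> \<longrightarrow> cmp_holds cm (measure (chain \<kappa> s) {w. psat I L w \<psi>}) (of_rat p))"
  by (simp add: schedulers_def forall_natures_iff[where Q="\<lambda>M. cmp_holds cm (measure M {w. psat I L w \<psi>}) (of_rat p)"])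

lemma sat_next_iff:
  "sat I L s (SProb cm p (PNext f)) \<longleftrightarrow>
    (\<exists>\<rho>. \<forall>\<mu>. trans_mix I s \<rho> \<mu> \<longrightarrow> cmp_holds cm (measure_pmf.prob \<mu> {s. sat I L s f}) (of_rat p))"
  unfolding sat_SProb_iff next_forces_iff[of "\<lambda>\<mu>. cmp_holds cm (measure_pmf.prob \<mu> {s. sat I L s f}) (of_rat p)" s, symmetric]
  using measure_next[OF path_dist_chain, of _ s "{s. sat I L s f}"] by simp

lemma sat_buntil_iff:
  "sat I L s (SProb cm p (PBUntil f k g)) \<longleftrightarrow>
    (\<exists>\<sigma>. \<forall>\<kappa>. admissible I \<sigma> \<kappa> \<longrightarrow> cmp_holds cm (buntil_prob {s. sat I L s f} {s. sat I L s g} \<kappa> k [s]) (of_rat p))"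
  unfolding sat_SProb_iff measure_until_event[OF path_dist_chain, symmetric]
  by (simp add: until_event_def)

lemma sat_until_iff:
  "sat I L s (SProb cm p (PUntil f g)) \<longleftrightarrow>
    (\<exists>\<sigma>. \<forall>\<kappa>. admissible I \<sigma> \<kappa> \<longrightarrow> cmp_holds cm (until_prob {s. sat I L s f} {s. sat I L s g} \<kappa> [s]) (of_rat p))"
proof -
  have "{w. psat I L w (PUntil f g)} = (\<Union>k. until_event {s. sat I L s f} {s. sat I L s g} 0 k)"
    by (auto simp: until_event_def)
  then show ?thesis
    unfolding sat_SProb_iff measure_until[OF path_dist_chain, symmetric] by simp
qed

text \<open>For a path formula the induction proves invariance of all probabilistic formulas built
  from it, with comparison and threshold generalised, so the \<open>SProb\<close> case is
  immediate.\<close>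

lemma class_inv_sat: "class_inv (\<lambda>s. sat I L s \<phi>)" and "class_inv (\<lambda>s. sat I L s (SProb cm p \<psi>))"
proof (induction \<phi> and \<psi> arbitrary: and cm p)
  case STrue
  then show ?case by (simp add: class_inv_def)
next
  case (SAtom x)
  then show ?case using bisim by (fastforce simp: class_inv_def bisim_def)
next
  case (SNot f)
  then show ?case by (simp add: class_inv_def)
next
  case (SAnd f g)
  then show ?case by (simp add: class_inv_def)
next
  case (SProb cm p \<psi>)
  then show ?case by blast
next
  case (PNext f)
  have f: "saturated {s. sat I L s f}" using PNext by simp
  have "saturated {s. sat I L s (SProb cm p (PNext f))}"
  proof (rule saturatedI)
    fix s t assume st: "(s, t) \<in> R" and "s \<in> {s. sat I L s (SProb cm p (PNext f))}"
    then have "\<exists>\<rho>. \<forall>\<mu>. trans_mix I s \<rho> \<mu> \<longrightarrow> cmp_holds cm (measure_pmf.prob \<mu> {s. sat I L s f}) (of_rat p)"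
      unfolding sat_next_iff by blast
    then have "\<exists>\<rho>. \<forall>\<mu>. trans_mix I t \<rho> \<mu> \<longrightarrow> cmp_holds cm (measure_pmf.prob \<mu> {s. sat I L s f}) (of_rat p)"
      by (rule transfer_choice[OF st, rotated])
        (use same_expv[OF _ saturated_indicator[OF f]] in \<open>simp add: expv_indicator\<close>)
    then show "t \<in> {s. sat I L s (SProb cm p (PNext f))}" unfolding sat_next_iff by blast
  qed
  then show ?case by (simp del: sat.simps)
next
  case (PUntil f g)
  have "saturated {s. sat I L s (SProb cm p (PUntil f g))}"
    by (rule saturatedI) (unfold mem_Collect_eq sat_until_iff, rule unbounded_transfer, use PUntil in auto)
  then show ?case by (simp del: sat.simps)
next
  case (PBUntil f k g)
  have "saturated {s. sat I L s (SProb cm p (PBUntil f k g))}"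
    by (rule saturatedI) (unfold mem_Collect_eq sat_buntil_iff, rule bounded_transfer, use PBUntil in auto)
  then show ?case by (simp del: sat.simps)
qed

end

theorem theorem2:
  fixes I :: "'s::finite \<Rightarrow> 'a::finite \<Rightarrow> 's \<Rightarrow> real set"
    and L :: "'s \<Rightarrow> 'p::finite set"
    and s t :: 's
    and \<phi> :: "'p sform"
  assumes "imdp I"
    and "bisimilar I L s t"
    and "wf_sform \<phi>"
  shows "sat I L s \<phi> \<longleftrightarrow> sat I L t \<phi>"
proof -
  obtain R where R: "bisim I L R" "(s, t) \<in> R" using assms(2) by (auto simp: bisimilar_def)
  interpret bisim_game I L R by unfold_locales (use assms(1) R in \<open>auto simp: imdp_def\<close>)
  show ?thesis using class_invD[OF class_inv_sat R(2)] .
qed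

end
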